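(* Let $Y\subset X$ be a compact right $U$-orbit and let $m=m(Y)$. For every bounded right $K$-invariant function $f=\Phi\circ h_K$ on $X$ and every $n\in\mathbb Z_{\ge0}$ with $n>m$, $$\left|\lambda^{\mathrm{per}}_{Y,n}(f)-\int_Xf\,d\mu_X\right|\ll_q\|\Phi\|_\infty q^{-(n-m-1)}.$$ In particular, $\lambda^{\mathrm{per}}_{Y,n}(f)\to\int_Xf\,d\mu_X$ as $n\to\infty$.
   Context: Let $q$ be a prime power, $F=\mathbb F_q((t^{-1}))$, $\mathcal O=\mathbb F_q[[t^{-1}]]$, $\pi=t^{-1}$, $G=\mathrm{SL}_2(F)$, $\Gamma=\mathrm{SL}_2(\mathbb F_q[t])$, $K=\mathrm{SL}_2(\mathcal O)$, $X=\Gamma\backslash G$, $\mu_X$ the normalized $G$-invariant probability measure on $X$. Put $u(s)=\begin{pmatrix}1&s\\0&1\end{pmatrix}$, $U=\{u(s):s\in F\}$ acting on $X$ on the right, $a_n=\mathrm{diag}(t^n,t^{-n})$, and let $ds$ be Haar measure on $F$ with $ds(\mathcal O)=1$. For a compact orbit $Y=\Gamma gU$, the parameter stabilizer $\Lambda_U(Y)=\{s\in F:\Gamma gu(s)=\Gamma g\}$ is a cocompact lattice in $F$ independent of the choice of $g$, of covolume $q^{-2m-1}$ for a unique integer $m=:m(Y)$. $\nu_Y$ is the normalized $U$-invariant probability measure on $Y$, and $\lambda^{\mathrm{per}}_{Y,n}(f)=\int_Yf(ya_{-n})\,d\nu_Y(y)$. Height map: $\mathcal T$ is the Bruhat--Tits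 tree of $\mathrm{PGL}_2(F)$ (vertices: homothety classes of $\mathcal O$-lattices in $F^2$; $[L],[L']$ adjacent if representatives satisfy $\pi L\subsetneq L'\subsetneq L$, $L/L'\simeq\mathbb F_q$). With $v_n=[\mathrm{diag}(t^n,1)]\cdot[\mathcal O^2]$, the quotient of $\mathcal T$ by $\mathrm{PGL}_2(\mathbb F_q[t])$ is the ray $v_0-v_1-\cdots$, and $h(v)$ is the $n\ge0$ for which $v$ lies in the orbit of $v_n$. $h_K:X\to2\mathbb Z_{\ge0}$, $h_K(\Gamma g)=h(gv_0)$. Right $K$-invariant functions on $X$ are exactly those of the form $\Phi\circ h_K$, $\Phi:2\mathbb Z_{\ge0}\to\mathbb C$. $A\ll_qB$ means $|A|\le C'B$ with $C'$ depending only on $q$. *)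

theory Defs
  imports "HOL-Probability.Probability" "HOL-Computational_Algebra.Formal_Laurent_Series"
begin

text \<open>The symbol \<open>$\<close> is reserved for vector components.\<close>

no_notation fps_nth (infixl \<open>$\<close> 75)

text \<open>
  A finite field with q elements is a type \<open>'a::{field,finite}\<close> with \<open>CARD('a) = q\<close>.
  The local field F of Laurent series in 1/t over it is the type \<open>'a fls\<close>, the formal variable
  \<open>fls_X\<close> being 1/t; hence \<open>fls_X_inv\<close> is t.  The metric topology that the library puts
  on \<open>'a fls\<close> is the (1/t)-adic one.
\<close>

section \<open>Rings and groups\<close>

definition Oring :: "'a::{field,finite} fls set" where
  "Oring = range fps_to_fls"

definition poly_ring :: "'a::{field,finite} fls set" where
  "poly_ring = range (\<lambda>p::'a poly. poly (map_poly fls_const p) fls_X_inv)"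

definition mat2 :: "'b::zero \<Rightarrow> 'b \<Rightarrow> 'b \<Rightarrow> 'b \<Rightarrow> 'b^2^2" where
  "mat2 a b c d = vector [vector [a, b], vector [c, d]]"

definition matrices_over :: "'b set \<Rightarrow> ('b^2^2) set" where
  "matrices_over R = {A. \<forall>i j. A $ i $ j \<in> R}"

definition SL2 :: "'b::comm_ring_1 set \<Rightarrow> ('b^2^2) set" where
  "SL2 R = {A \<in> matrices_over R. det A = 1}"

definition GL2 :: "'b::comm_ring_1 set \<Rightarrow> ('b^2^2) set" where
  "GL2 R = {A \<in> matrices_over R. \<exists>B \<in> matrices_over R. A ** B = mat 1 \<and> B ** A = mat 1}"

abbreviation Ggrp :: "('a::{field,finite} fls^2^2) set" where
  "Ggrp \<equiv> SL2 UNIV"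

abbreviation Gam :: "('a::{field,finite} fls^2^2) set" where
  "Gam \<equiv> SL2 poly_ring"

definition uni :: "'a::{field,finite} fls \<Rightarrow> 'a fls^2^2" where
  "uni s = mat2 1 s 0 1"

definition adiag :: "int \<Rightarrow> 'a::{field,finite} fls^2^2" where
  "adiag n = mat2 (fls_X_inv powi n) 0 0 (fls_X_inv powi (- n))"


section \<open>The homogeneous space\<close>

type_synonym 'a point = "('a fls^2^2) set"

definition Gcoset :: "'a::{field,finite} fls^2^2 \<Rightarrow> 'a point" where
  "Gcoset g = (\<lambda>\<gamma>. \<gamma> ** g) ` Gam"

definition Xsp :: "'a::{field,finite} point set" where
  "Xsp = Gcoset ` Ggrp"

definition ract :: "'a::{field,finite} point \<Rightarrow> 'a fls^2^2 \<Rightarrow> 'a point" where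
  "ract x g = (\<lambda>h. h ** g) ` x"

text \<open>The quotient topology on the coset space, from the subspace topology on the group.\<close>

definition Xtop :: "'a::{field,finite} point topology" where
  "Xtop = topology (\<lambda>V. V \<subseteq> Xsp \<and> openin (top_of_set Ggrp) {g \<in> Ggrp. Gcoset g \<in> V})"

definition borel_on :: "'b topology \<Rightarrow> 'b measure" where
  "borel_on T = sigma (topspace T) {V. openin T V}"

definition invariant_prob_X :: "'a::{field,finite} point measure \<Rightarrow> bool" where
  "invariant_prob_X \<mu> \<longleftrightarrow>
     prob_space \<mu> \<and> space \<mu> = Xsp \<and> sets \<mu> = sets (borel_on Xtop) \<and>
     (\<forall>g \<in> Ggrp. distr \<mu> \<mu> (\<lambda>x. ract x g) = \<mu>)"


section \<open>Compact unipotent orbits\<close>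

definition Uorbit :: "'a::{field,finite} point \<Rightarrow> 'a point set" where
  "Uorbit x = range (\<lambda>s. ract x (uni s))"

definition compact_Uorbit :: "'a::{field,finite} point set \<Rightarrow> bool" where
  "compact_Uorbit Y \<longleftrightarrow> (\<exists>g \<in> Ggrp. Y = Uorbit (Gcoset g)) \<and> compactin Xtop Y"

definition invariant_prob_orbit ::
  "'a::{field,finite} point set \<Rightarrow> 'a point measure \<Rightarrow> bool" where
  "invariant_prob_orbit Y \<nu> \<longleftrightarrow>
     prob_space \<nu> \<and> space \<nu> = Y \<and> sets \<nu> = sets (borel_on (subtopology Xtop Y)) \<and>
     (\<forall>s. distr \<nu> \<nu> (\<lambda>y. ract y (uni s)) = \<nu>)"

definition lambda_per ::
  "'a::{field,finite} point measure \<Rightarrow> nat \<Rightarrow> ('a point \<Rightarrow> complex) \<Rightarrow> complex" where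
  "lambda_per \<nu> n f = (\<integral>y. f (ract y (adiag (- int n))) \<partial>\<nu>)"

text \<open>
  The parameter stabilizer of an orbit.  The condition does not depend on the base point in Y;
  lemma \<open>stabU_Uorbit\<close> below identifies it with the stabilizer of any chosen one.
\<close>

definition stabU :: "'a::{field,finite} point set \<Rightarrow> 'a fls set" where
  "stabU Y = {s. \<forall>y \<in> Y. ract y (uni s) = y}"

definition normalized_haar :: "'a::{field,finite} fls measure \<Rightarrow> bool" where
  "normalized_haar ds \<longleftrightarrow>
     sets ds = sets borel \<and> (\<forall>c. distr ds ds (\<lambda>x. c + x) = ds) \<and> emeasure ds Oring = 1"

definition fundamental_domain :: "'a::{field,finite} fls set \<Rightarrow> 'a fls set \<Rightarrow> bool" where
  "fundamental_domain \<Lambda> D \<longleftrightarrow> D \<in> sets borel \<and> (\<forall>x. \<exists>!l. l \<in> \<Lambda> \<and> x - l \<in> D)"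

text \<open>For a lattice, all Borel fundamental domains have the same Haar measure.\<close>

definition covolume :: "'a::{field,finite} fls measure \<Rightarrow> 'a fls set \<Rightarrow> ennreal" where
  "covolume ds \<Lambda> = (THE c. \<exists>D. fundamental_domain \<Lambda> D \<and> c = emeasure ds D)"

definition m_orbit :: "'a::{field,finite} fls measure \<Rightarrow> 'a point set \<Rightarrow> int" where
  "m_orbit ds Y =
     (THE m. covolume ds (stabU Y) = ennreal (real CARD('a) powi (- 2 * m - 1)))"


section \<open>The height map\<close>

text \<open>
  A vertex of the tree is a homothety class of lattices in the plane, i.e. a set of lattices.
  The edges of the tree play no role in the definition of the height.  Scalar matrices fix all
  vertices, so orbits under PGL2 are orbits under GL2.
\<close>

type_synonym 'a vertex = "('a fls^2) set set"

definition homothety_class :: "('a::{field,finite} fls^2) set \<Rightarrow> 'a vertex" where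
  "homothety_class L = {(\<lambda>x. c *s x) ` L | c. c \<noteq> 0}"

definition vact :: "'a::{field,finite} fls^2^2 \<Rightarrow> 'a vertex \<Rightarrow> 'a vertex" where
  "vact g v = (\<lambda>L. (\<lambda>x. g *v x) ` L) ` v"

definition std_lattice :: "('a::{field,finite} fls^2) set" where
  "std_lattice = {x. \<forall>i. x $ i \<in> Oring}"

definition v_ray :: "nat \<Rightarrow> 'a::{field,finite} vertex" where
  "v_ray n = vact (mat2 (fls_X_inv ^ n) 0 0 1) (homothety_class std_lattice)"

definition tree_height :: "'a::{field,finite} vertex \<Rightarrow> nat" where
  "tree_height v = (THE n. \<exists>\<gamma> \<in> GL2 poly_ring. v = vact \<gamma> (v_ray n))"

text \<open>Representative-independence is lemma \<open>hK_Gcoset\<close> below.\<close>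

definition hK :: "'a::{field,finite} point \<Rightarrow> nat" where
  "hK x = (THE k. \<forall>g \<in> x. tree_height (vact g (v_ray 0)) = k)"

definition sup_norm_even :: "(nat \<Rightarrow> complex) \<Rightarrow> real" where
  "sup_norm_even \<Phi> = (SUP k \<in> {k. even k}. cmod (\<Phi> k))"


section \<open>Well-definedness\<close>

lemma openin_Xtop:
  "openin Xtop V \<longleftrightarrow> V \<subseteq> Xsp \<and> openin (top_of_set Ggrp) {g \<in> Ggrp. Gcoset g \<in> V}"
proof -
  have "istopology (\<lambda>V. V \<subseteq> (Xsp :: 'a point set) \<and>
          openin (top_of_set Ggrp) {g \<in> Ggrp. Gcoset g \<in> V})"
    unfolding istopology_def
  proof (intro conjI allI impI)
    fix S T :: "'a point set"
    assume S: "S \<subseteq> Xsp \<and> openin (top_of_set Ggrp) {g \<in> Ggrp. Gcoset g \<in> S}"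
      and T: "T \<subseteq> Xsp \<and> openin (top_of_set Ggrp) {g \<in> Ggrp. Gcoset g \<in> T}"
    show "S \<inter> T \<subseteq> Xsp" using S by blast
    have "{g \<in> Ggrp. Gcoset g \<in> S \<inter> T} =
        {g \<in> Ggrp. Gcoset g \<in> S} \<inter> {g \<in> Ggrp. Gcoset g \<in> T}" by blast
    then show "openin (top_of_set Ggrp) {g \<in> Ggrp. Gcoset g \<in> S \<inter> T}"
      using openin_Int[OF conjunct2[OF S] conjunct2[OF T]] by (simp only:)
  next
    fix \<K> :: "'a point set set"
    assume K: "\<forall>V\<in>\<K>. V \<subseteq> Xsp \<and> openin (top_of_set Ggrp) {g \<in> Ggrp. Gcoset g \<in> V}"
    show "\<Union>\<K> \<subseteq> Xsp" using K by blast
    have "{g \<in> Ggrp. Gcoset g \<in> \<Union>\<K>} = (\<Union>V\<in>\<K>. {g \<in> Ggrp. Gcoset g \<in> V})" by blast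
    then show "openin (top_of_set Ggrp) {g \<in> Ggrp. Gcoset g \<in> \<Union>\<K>}"
      using K by (simp only:) (intro openin_Union, blast)
  qed
  then show ?thesis by (simp add: Xtop_def)
qed

lemma topspace_Xtop: "topspace Xtop = Xsp"
proof -
  have "{g \<in> Ggrp. Gcoset g \<in> Xsp} = (Ggrp :: ('a fls^2^2) set)"
    by (auto simp: Xsp_def)
  then have "openin Xtop (Xsp :: 'a point set)"
    by (simp add: openin_Xtop)
  then show ?thesis
    by (metis openin_Xtop openin_subset openin_topspace subset_antisym)
qed

lemma ract_ract: "ract (ract x g) h = ract x (g ** h)"
  by (auto simp: ract_def image_image matrix_mul_assoc)

lemma uni_mult: "uni s ** uni r = uni (s + r)"
  by (simp add: uni_def mat2_def vec_eq_iff matrix_matrix_mult_def sum_2 forall_2 add.commute)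

lemma stabU_Uorbit: "stabU (Uorbit x) = {s. ract x (uni s) = x}"
proof -
  have "uni 0 = (mat 1 :: 'a fls^2^2)"
    by (simp add: uni_def mat2_def vec_eq_iff mat_def forall_2)
  then have "ract x (uni 0) = x" by (simp add: ract_def)
  then have "x \<in> Uorbit x" unfolding Uorbit_def by (metis rangeI)
  moreover have "ract (ract x (uni r)) (uni s) = ract x (uni r)" if "ract x (uni s) = x" for r s
    using that by (metis ract_ract uni_mult add.commute)
  ultimately show ?thesis unfolding stabU_def Uorbit_def by (intro Collect_cong) blast
qed

lemma poly_ring_0: "0 \<in> poly_ring"
  unfolding poly_ring_def by (rule range_eqI[of _ _ 0]) simp

lemma poly_ring_1: "1 \<in> poly_ring"
  unfolding poly_ring_def by (rule range_eqI[of _ _ 1]) simp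

lemma poly_ring_add: "x \<in> poly_ring \<Longrightarrow> y \<in> poly_ring \<Longrightarrow> x + y \<in> poly_ring"
proof -
  assume "x \<in> poly_ring" "y \<in> poly_ring"
  then obtain p q :: "'a poly" where "x = poly (map_poly fls_const p) fls_X_inv"
    "y = poly (map_poly fls_const q) fls_X_inv" by (auto simp: poly_ring_def)
  moreover have "map_poly fls_const (p + q) = map_poly fls_const p + map_poly fls_const q"
    by (intro poly_eqI) (simp add: coeff_map_poly fls_plus_const)
  ultimately have "x + y = poly (map_poly fls_const (p + q)) fls_X_inv" by simp
  then show ?thesis by (auto simp: poly_ring_def)
qed

lemma poly_ring_mult: "x \<in> poly_ring \<Longrightarrow> y \<in> poly_ring \<Longrightarrow> x * y \<in> poly_ring"
proof -
  assume "x \<in> poly_ring" "y \<in> poly_ring"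
  then obtain p q :: "'a poly" where "x = poly (map_poly fls_const p) fls_X_inv"
    "y = poly (map_poly fls_const q) fls_X_inv" by (auto simp: poly_ring_def)
  moreover have "fls_const (sum f A) = (\<Sum>i\<in>A. fls_const (f i))" for f :: "nat \<Rightarrow> 'a" and A
    by (induction A rule: infinite_finite_induct) (simp_all flip: fls_plus_const)
  then have "map_poly fls_const (p * q) = map_poly fls_const p * map_poly fls_const q"
    by (intro poly_eqI) (simp add: coeff_map_poly coeff_mult flip: fls_const_mult_const)
  ultimately have "x * y = poly (map_poly fls_const (p * q)) fls_X_inv" by simp
  then show ?thesis by (auto simp: poly_ring_def)
qed

lemma poly_ring_uminus: "x \<in> poly_ring \<Longrightarrow> - x \<in> poly_ring"
proof -
  assume "x \<in> poly_ring"
  then obtain p :: "'a poly" where "x = poly (map_poly fls_const p) fls_X_inv"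
    by (auto simp: poly_ring_def)
  moreover have "map_poly fls_const (- p) = - map_poly fls_const p"
    by (intro poly_eqI) (simp add: coeff_map_poly)
  ultimately have "- x = poly (map_poly fls_const (- p)) fls_X_inv" by simp
  then show ?thesis by (auto simp: poly_ring_def)
qed

lemma GL2_mult:
  fixes A B :: "'a::{field,finite} fls^2^2"
  assumes "A \<in> GL2 poly_ring" "B \<in> GL2 poly_ring"
  shows "A ** B \<in> GL2 poly_ring"
proof -
  have M: "C ** D \<in> matrices_over poly_ring"
    if "C \<in> matrices_over poly_ring" "D \<in> matrices_over poly_ring" for C D :: "'a fls^2^2"
    using that by (auto simp: matrices_over_def matrix_matrix_mult_def sum_2
        intro!: poly_ring_add poly_ring_mult)
  from assms obtain A' B' where
    "A \<in> matrices_over poly_ring" "A' \<in> matrices_over poly_ring" "A ** A' = mat 1" "A' ** A = mat 1"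
    "B \<in> matrices_over poly_ring" "B' \<in> matrices_over poly_ring" "B ** B' = mat 1" "B' ** B = mat 1"
    by (auto simp: GL2_def)
  moreover from this have "(A ** B) ** (B' ** A') = mat 1" "(B' ** A') ** (A ** B) = mat 1"
    by (metis matrix_mul_assoc matrix_mul_rid)+
  ultimately show ?thesis by (auto simp: GL2_def intro!: M)
qed

lemma SL2_subset_GL2: "Gam \<subseteq> GL2 poly_ring"
proof
  fix A :: "'a fls^2^2" assume A: "A \<in> Gam"
  define B where "B = mat2 (A $ 2 $ 2) (- A $ 1 $ 2) (- A $ 2 $ 1) (A $ 1 $ 1)"
  have "B \<in> matrices_over poly_ring"
    using A by (auto simp: SL2_def matrices_over_def B_def mat2_def forall_2 intro: poly_ring_uminus)
  moreover have "A ** B = mat 1" "B ** A = mat 1"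
    using A by (simp_all add: SL2_def B_def mat2_def vec_eq_iff matrix_matrix_mult_def sum_2
        forall_2 mat_def det_2 algebra_simps)
  ultimately show "A \<in> GL2 poly_ring" using A by (auto simp: GL2_def SL2_def)
qed

lemma vact_vact: "vact g (vact h v) = vact (g ** h) v"
  by (simp add: vact_def image_image matrix_vector_mul_assoc)

lemma vact_1: "vact (mat 1) v = v"
  by (simp add: vact_def)

lemma tree_height_GL2:
  assumes "\<delta> \<in> GL2 poly_ring"
  shows "tree_height (vact \<delta> v) = tree_height v"
proof -
  from assms obtain \<delta>' where d: "\<delta>' \<in> GL2 poly_ring" "\<delta>' ** \<delta> = mat 1"
    by (auto simp: GL2_def)
  have "(\<exists>\<gamma> \<in> GL2 poly_ring. vact \<delta> v = vact \<gamma> (v_ray n)) \<longleftrightarrow>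
      (\<exists>\<gamma> \<in> GL2 poly_ring. v = vact \<gamma> (v_ray n))" for n
    using d assms by (metis GL2_mult vact_vact vact_1)
  then show ?thesis by (simp add: tree_height_def)
qed

lemma hK_Gcoset: "hK (Gcoset g) = tree_height (vact g (v_ray 0))"
proof -
  have "mat 1 \<in> (Gam :: ('a fls^2^2) set)"
    by (simp add: SL2_def matrices_over_def) (simp add: mat_def poly_ring_0 poly_ring_1)
  then have "g \<in> Gcoset g" unfolding Gcoset_def by (metis image_eqI matrix_mul_lid)
  moreover have "tree_height (vact h (v_ray 0)) = tree_height (vact g (v_ray 0))" if "h \<in> Gcoset g" for h
    using that SL2_subset_GL2 by (auto simp: Gcoset_def simp flip: vact_vact intro!: tree_height_GL2)
  ultimately show ?thesis unfolding hK_def by (intro the_equality ballI) (blast, metis)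
qed

lemma Oring_add: "x \<in> Oring \<Longrightarrow> y \<in> Oring \<Longrightarrow> x + y \<in> Oring"
  by (auto simp: Oring_def simp flip: fps_to_fls_plus)

lemma Oring_mult: "x \<in> Oring \<Longrightarrow> y \<in> Oring \<Longrightarrow> x * y \<in> Oring"
  by (auto simp: Oring_def simp flip: fls_times_fps_to_fls)

lemma Oring_uminus: "x \<in> Oring \<Longrightarrow> - x \<in> Oring"
  by (auto simp: Oring_def simp flip: fps_to_fls_uminus)

text \<open>Functions of the height are right invariant under the maximal compact subgroup.\<close>

lemma vact_SL2_Oring:
  fixes k :: "'a::{field,finite} fls^2^2"
  assumes k: "k \<in> SL2 Oring"
  shows "vact k (v_ray 0) = v_ray 0"
proof -
  define k' where "k' = mat2 (k $ 2 $ 2) (- (k $ 1 $ 2)) (- (k $ 2 $ 1)) (k $ 1 $ 1)"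
  have k': "k' \<in> matrices_over Oring"
    using k by (simp add: SL2_def matrices_over_def k'_def mat2_def forall_2 Oring_uminus)
  have kk': "k ** k' = mat 1"
    using k by (simp add: SL2_def k'_def mat2_def vec_eq_iff matrix_matrix_mult_def sum_2
        forall_2 mat_def det_2 algebra_simps)
  have pres: "B *v x \<in> std_lattice" if "B \<in> matrices_over Oring" "x \<in> std_lattice"
    for B :: "'a fls^2^2" and x
    using that by (simp add: matrices_over_def std_lattice_def matrix_vector_mult_def sum_2
        Oring_add Oring_mult)
  have L: "(\<lambda>x. k *v x) ` std_lattice = std_lattice"
  proof
    show "(\<lambda>x. k *v x) ` std_lattice \<subseteq> std_lattice"
      using k pres by (auto simp: SL2_def)
    show "std_lattice \<subseteq> (\<lambda>x. k *v x) ` std_lattice"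
    proof
      fix x :: "'a fls^2" assume "x \<in> std_lattice"
      then have "k' *v x \<in> std_lattice" using k' pres by blast
      moreover have "x = k *v (k' *v x)" by (simp add: matrix_vector_mul_assoc kk')
      ultimately show "x \<in> (\<lambda>x. k *v x) ` std_lattice" by blast
    qed
  qed
  have comm: "(\<lambda>x. k *v x) ` (\<lambda>x. c *s x) ` std_lattice = (\<lambda>x. c *s x) ` std_lattice" for c
  proof -
    have "(\<lambda>x. k *v x) ` (\<lambda>x. c *s x) ` std_lattice =
        (\<lambda>x. c *s x) ` (\<lambda>x. k *v x) ` std_lattice"
      by (simp add: image_image vector_scalar_commute)
    then show ?thesis by (simp add: L)
  qed
  have "vact k (homothety_class std_lattice) = homothety_class std_lattice"
    unfolding vact_def homothety_class_def setcompr_eq_image image_image[of _ _ "{c. c \<noteq> 0}"]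
    by (simp only: comm)
  moreover have "mat2 (fls_X_inv ^ 0) 0 0 1 = (mat 1 :: 'a fls^2^2)"
    by (simp add: mat2_def vec_eq_iff mat_def forall_2)
  ultimately show ?thesis by (simp add: v_ray_def vact_1)
qed

lemma hK_ract_SL2_Oring:
  assumes "x \<in> Xsp" "k \<in> SL2 Oring"
  shows "hK (ract x k) = hK x"
proof -
  obtain g where x: "x = Gcoset g" using assms by (auto simp: Xsp_def)
  have "ract (Gcoset g) k = Gcoset (g ** k)"
    by (simp add: ract_def Gcoset_def image_image matrix_mul_assoc)
  moreover have "vact (g ** k) (v_ray 0) = vact g (v_ray 0)"
    by (metis vact_vact vact_SL2_Oring assms(2))
  ultimately show ?thesis by (simp add: x hK_Gcoset)
qed

end

theory Submission
  imports Defs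
begin

text \<open>
  Write \<open>q\<close> for the size of the field and \<open>P\<close> for the polynomials in
  \<open>t\<close>. To \<open>g\<close> belongs the lattice \<open>P\<^sup>2 g\<close> of row
  vectors, which depends only on the coset of \<open>g\<close>. By reduction theory
  (\<open>reduction\<close>) \<open>g\<close> lies in \<open>\<Gamma> diag(t^k, t^-k) K\<close>
  for some \<open>k \<ge> 0\<close>. Then its height is \<open>2k\<close>
  (\<open>hK_reduced\<close>), and the number \<open>W\<^sub>j\<close> of lattice vectors with
  both entries of absolute value at most \<open>q^-j\<close> is an explicit function of
  \<open>k\<close> (\<open>hK_and_short_vectors\<close>). For \<open>j \<ge> 1\<close> the
  combination \<open>q W\<^sub>j\<^sub>+\<^sub>1 - W\<^sub>j\<close> is \<open>q - 1\<close> when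
  the height is below \<open>2j\<close> and \<open>0\<close> otherwise, so the distribution of the
  height under an average of group elements can be found by counting lattice vectors. All lattice
  vectors are counted, not only primitive ones, which makes the counting problems linear over the
  finite field.

  For the invariant measure, average over the \<open>q (q + 1)\<close> elements that represent the
  cosets of \<open>K\<close> in \<open>K diag(t, t^-1) K\<close>. For every nonzero vector,
  \<open>1\<close>, \<open>q - 1\<close> and \<open>q\<^sup>2\<close> of them multiply its norm by
  \<open>q^-1\<close>, \<open>1\<close> and \<open>q\<close> (\<open>hecke_count\<close>), and
  this gives a three-term relation among the \<open>W\<^sub>j\<close>. Invariance turns it into a
  recursion for \<open>\<mu>(height < 2j)\<close>. These numbers tend to \<open>1\<close>, so
  \<open>\<mu>(height < 2j) = 1 - q^(1-2j)\<close> for \<open>j \<ge> 1\<close>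
  (\<open>invariant_prob_X_height\<close>).

  For the orbit, compactness bounds the height on \<open>Y\<close>. This forces the lattice to
  contain a vector of the line fixed by \<open>U\<close>, and \<open>Y\<close> is the
  \<open>U\<close>-orbit of some \<open>diag(a, a^-1)\<close>
  (\<open>compact_Uorbit_cusp\<close>). The stabilizer is \<open>a^-2 P\<close>, so
  \<open>m(Y)\<close> is the degree of \<open>a\<close> in \<open>t\<close>
  (\<open>m_orbit_torus\<close>). Put \<open>N = n - m\<close>. The translated function is
  invariant under a small ball of \<open>U\<close>, so that its mean is a finite average over
  parameters \<open>r\<close>. For a fixed first entry \<open>c \<noteq> 0\<close> of a lattice
  vector, \<open>r \<mapsto> c r\<close> followed by truncation is a homomorphism onto a finite
  group; its fibres have equal size and the count is exact
  (\<open>sum_short_vectors_periodic\<close>). The outcome is again \<open>1 - q^(1-2j)\<close>,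
  now for \<open>1 \<le> j \<le> N\<close> (\<open>invariant_prob_orbit_height\<close>).

  Hence both height distributions agree below \<open>2N\<close>, and each gives mass
  \<open>q^(1-2N)\<close> to the rest. The two integrals differ by at most \<open>2
  q^(1-2N)\<close> times the supremum of \<open>\<Phi>\<close>, which is even smaller than the
  stated bound.
\<close>

section \<open>Balls, polynomials and truncation in the field of Laurent series\<close>

notation fls_nth (infixl \<open>$$\<close> 75)

text \<open>
  The ball of radius \<open>q^-n\<close>, that is, the fractional ideal \<open>t^-n O\<close>. All
  estimates of absolute values are written as membership in such balls.
\<close>

definition fball :: "int \<Rightarrow> 'a::{field,finite} fls set" where
  "fball n = {x. \<forall>i<n. x $$ i = 0}"

lemma fball_iff: "x \<in> fball n \<longleftrightarrow> x = 0 \<or> n \<le> fls_subdegree x"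
proof (cases "x = 0")
  case False
  show ?thesis
  proof
    assume "x \<in> fball n"
    then show "x = 0 \<or> n \<le> fls_subdegree x"
      using False nth_fls_subdegree_nonzero[of x] by (force simp: fball_def)
  qed (auto simp: fball_def False)
qed (simp add: fball_def)

lemma fball_0 [simp]: "0 \<in> fball n"
  by (simp add: fball_def)

lemma fball_add: "x \<in> fball n \<Longrightarrow> y \<in> fball n \<Longrightarrow> x + y \<in> fball n"
  by (simp add: fball_def)

lemma fball_diff: "x \<in> fball n \<Longrightarrow> y \<in> fball n \<Longrightarrow> x - y \<in> fball n"
  by (simp add: fball_def)

lemma fball_uminus_iff [simp]: "- x \<in> fball n \<longleftrightarrow> x \<in> fball n"
  by (simp add: fball_def)

lemma fball_mono: "x \<in> fball m \<Longrightarrow> n \<le> m \<Longrightarrow> x \<in> fball n"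
  by (simp add: fball_def)

lemma fball_mult: "x \<in> fball m \<Longrightarrow> y \<in> fball n \<Longrightarrow> x * y \<in> fball (m + n)"
  by (cases "x = 0 \<or> y = 0") (auto simp: fball_iff)

lemma fball_mult_iff: "x \<noteq> 0 \<Longrightarrow> x * y \<in> fball n \<longleftrightarrow> y \<in> fball (n - fls_subdegree x)"
  by (cases "y = 0") (auto simp: fball_iff)

lemma fball_Suc_iff: "x \<in> fball (n + 1) \<longleftrightarrow> x \<in> fball n \<and> x $$ n = 0"
  using zless_add1_eq[of _ n] by (auto simp: fball_def)

lemma fball_absorbing: "\<exists>n\<le>k. x \<in> fball n"
  by (cases "x = 0") (auto simp: fball_iff intro!: exI[of _ "min k (fls_subdegree x)"])

lemma Oring_eq_fball: "Oring = fball 0"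
proof
  show "fball 0 \<subseteq> (Oring :: 'a fls set)"
  proof
    fix x :: "'a fls" assume "x \<in> fball 0"
    then have "x = fps_to_fls (fls_regpart x)"
      by (intro fls_eqI) (auto simp: fball_def)
    then show "x \<in> Oring" unfolding Oring_def by blast
  qed
qed (auto simp: Oring_def fball_def)

lemma one_fball [simp]: "1 \<in> fball 0"
  by (simp add: fball_def)

abbreviation tpow :: "int \<Rightarrow> 'a::{field,finite} fls" where
  "tpow k \<equiv> fls_X_inv powi k"

lemma tpow_conv_shift: "tpow k = fls_shift k 1"
proof -
  have "fls_X_inv powi k = inverse (fls_X :: 'a fls) powi k"
    by (simp add: fls_inverse_X)
  also have "\<dots> = fls_X powi (- k)"
    by (simp add: power_int_minus power_int_inverse)
  finally show ?thesis by simp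
qed

lemma tpow_nonzero [simp]: "tpow k \<noteq> 0"
  by (metis fls_X_inv_nonzero power_int_not_zero)

lemma subdegree_tpow [simp]: "fls_subdegree (tpow k :: 'a::{field,finite} fls) = - k"
  by (simp add: tpow_conv_shift del: fls_X_power_int)

lemma tpow_add: "tpow (k + l) = tpow k * tpow l"
  by (simp add: power_int_add)

lemma tpow_mult_minus [simp]: "tpow k * tpow (- k) = 1" "tpow (- k) * tpow k = 1"
  by (simp_all add: power_int_minus)

lemma tpow_times_fball_iff [simp]:
  "tpow k * x \<in> fball n \<longleftrightarrow> x \<in> fball (n + k)"  "x * tpow k \<in> fball n \<longleftrightarrow> x \<in> fball (n + k)"
  by (simp_all add: fball_mult_iff mult.commute[of x "tpow k"])

lemma nth_poly_at_t:
  "poly (map_poly fls_const p) (fls_X_inv :: 'a::{field,finite} fls) $$ n =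
     (if n \<le> 0 then coeff p (nat (- n)) else 0)"
proof (induction p arbitrary: n)
  case 0
  then show ?case by simp
next
  case (pCons a p)
  have "nat (- n) = Suc (nat (- (n + 1)))" if "n < 0"
    using that by simp
  then show ?case
    by (auto simp: map_poly_pCons pCons.IH fls_X_inv_times_conv_shift)
qed

lemma poly_ring_iff: "x \<in> poly_ring \<longleftrightarrow> (\<forall>i>0. x $$ i = 0)"
proof
  assume x: "\<forall>i>0. x $$ i = 0"
  define p where "p = Abs_poly (\<lambda>n. x $$ (- int n))"
  have "coeff p n = x $$ (- int n)" for n
    unfolding p_def by (subst Abs_poly_inverse) (use MOST_fls_neg_nth_eq_0[of x] in simp_all)
  then have "x = poly (map_poly fls_const p) fls_X_inv"
    by (intro fls_eqI) (simp add: nth_poly_at_t x)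
  then show "x \<in> poly_ring" unfolding poly_ring_def by blast
qed (auto simp: poly_ring_def nth_poly_at_t)

lemma poly_ring_diff: "x \<in> poly_ring \<Longrightarrow> y \<in> poly_ring \<Longrightarrow> x - y \<in> poly_ring"
  by (simp add: poly_ring_iff)

text \<open>
  A nonzero polynomial in \<open>t\<close> has absolute value at least \<open>1\<close>; together
  with \<open>poly_ring_approx\<close> below this says that the maximal ideal of the valuation
  ring is a fundamental domain for the polynomials.
\<close>

lemma poly_ring_Int_fball: "x \<in> poly_ring \<Longrightarrow> x \<in> fball 1 \<Longrightarrow> x = 0"
proof (rule fls_zero_eqI)
  fix n assume "x \<in> poly_ring" "x \<in> fball 1"
  then show "x $$ n = 0" by (cases "n > 0") (auto simp: poly_ring_iff fball_def)
qed

definition trunc :: "int \<Rightarrow> int \<Rightarrow> 'a::{field,finite} fls \<Rightarrow> 'a fls" where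
  "trunc l h x = Abs_fls (\<lambda>i. if l \<le> i \<and> i < h then x $$ i else 0)"

lemma nth_trunc [simp]: "trunc l h x $$ i = (if l \<le> i \<and> i < h then x $$ i else 0)"
  unfolding trunc_def by (rule nth_Abs_fls_lower_bound[of l]) simp

lemma trunc_add: "trunc l h (x + y) = trunc l h x + trunc l h y"
  by (rule fls_eqI) simp

definition supp_in :: "int \<Rightarrow> int \<Rightarrow> 'a::{field,finite} fls set" where
  "supp_in l h = {x. \<forall>i. i < l \<or> h \<le> i \<longrightarrow> x $$ i = 0}"

lemma trunc_in_supp_in: "trunc l h x \<in> supp_in l h"
  by (simp add: supp_in_def)

lemma poly_ring_approx: "\<exists>p\<in>poly_ring. x - p \<in> fball 1"
proof (intro bexI)
  show "x - trunc (fls_subdegree x) 1 x \<in> fball 1" by (simp add: fball_def)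
qed (simp add: poly_ring_iff)

lemma poly_ring_Int_fball_eq_supp_in: "poly_ring \<inter> fball n = supp_in n 1"
  by (auto simp: poly_ring_iff fball_def supp_in_def)

text \<open>
  The coefficients in the window \<open>[l, h)\<close> are free; this gives the cardinality
  \<open>q^(h-l)\<close> for \<open>l \<le> h\<close>.
\<close>

lemma bij_betw_supp_in:
  "bij_betw (\<lambda>f. Abs_fls (\<lambda>i. if i \<in> {l..<h} then f i else 0))
     ({l..<h} \<rightarrow>\<^sub>E (UNIV :: 'a set)) (supp_in l h :: 'a::{field,finite} fls set)"
proof -
  have nth: "Abs_fls (\<lambda>i. if i \<in> {l..<h} then f i else 0) $$ j =
      (if j \<in> {l..<h} then f j else 0)" for f :: "int \<Rightarrow> 'a" and j
    by (rule nth_Abs_fls_lower_bound[of l]) simp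
  let ?F = "\<lambda>f. Abs_fls (\<lambda>i. if i \<in> {l..<h} then f i else 0) :: 'a fls"
  let ?R = "\<lambda>x :: 'a fls. restrict (\<lambda>i. x $$ i) {l..<h}"
  have 1: "?R (?F f) = f" if "f \<in> {l..<h} \<rightarrow>\<^sub>E UNIV" for f
  proof
    fix i
    show "?R (?F f) i = f i"
      unfolding restrict_apply nth using PiE_arb[OF that, of i] by (cases "i \<in> {l..<h}") simp_all
  qed
  have 2: "?F (?R x) = x" if "x \<in> supp_in l h" for x
  proof (rule fls_eqI)
    fix i
    show "?F (?R x) $$ i = x $$ i"
      unfolding nth restrict_apply using that by (auto simp: supp_in_def not_le)
  qed
  have 3: "?F f \<in> supp_in l h" for f
    unfolding supp_in_def mem_Collect_eq nth by simp
  show ?thesis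
  proof (rule bij_betw_byWitness[where f' = ?R])
    show "\<forall>f\<in>{l..<h} \<rightarrow>\<^sub>E UNIV. ?R (?F f) = f" by (rule ballI) (rule 1)
    show "\<forall>x\<in>supp_in l h. ?F (?R x) = x" by (rule ballI) (rule 2)
    show "?F ` ({l..<h} \<rightarrow>\<^sub>E UNIV) \<subseteq> supp_in l h" by (rule image_subsetI) (rule 3)
    show "?R ` supp_in l h \<subseteq> {l..<h} \<rightarrow>\<^sub>E UNIV" by (rule image_subsetI) simp
  qed
qed

lemma finite_supp_in [simp]: "finite (supp_in l h :: 'a::{field,finite} fls set)"
  using bij_betw_finite[OF bij_betw_supp_in] by (simp add: finite_PiE)

lemma card_supp_in: "card (supp_in l h :: 'a::{field,finite} fls set) = CARD('a) ^ nat (h - l)"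
proof -
  have "card ({l..<h} \<rightarrow>\<^sub>E (UNIV :: 'a set)) = card (supp_in l h :: 'a fls set)"
    by (rule bij_betw_same_card[OF bij_betw_supp_in])
  then show ?thesis by (simp add: card_PiE)
qed

lemma zero_in_supp_in [simp]: "0 \<in> supp_in l h"
  by (simp add: supp_in_def)

lemma two_le_card_field: "2 \<le> CARD('a::{field,finite})"
proof -
  have "card {0, 1 :: 'a} \<le> CARD('a)" by (intro card_mono) auto
  then show ?thesis by simp
qed

section \<open>Two-by-two matrices and cosets\<close>

lemma mat2_nth [simp]:
  "mat2 a b c d $ 1 $ 1 = a" "mat2 a b c d $ 1 $ 2 = b"
  "mat2 a b c d $ 2 $ 1 = c" "mat2 a b c d $ 2 $ 2 = d"
  by (simp_all add: mat2_def)

lemma mat2_eq_iff: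
  "A = B \<longleftrightarrow> A $ 1 $ 1 = B $ 1 $ 1 \<and> A $ 1 $ 2 = B $ 1 $ 2 \<and> A $ 2 $ 1 = B $ 2 $ 1 \<and> A $ 2 $ 2 = B $ 2 $ 2"
  for A B :: "'b::zero^2^2"
  by (auto simp: vec_eq_iff forall_2)

lemma mat2_cases: obtains a b c d where "(A :: 'b::zero^2^2) = mat2 a b c d"
  using that[of "A $ 1 $ 1" "A $ 1 $ 2" "A $ 2 $ 1" "A $ 2 $ 2"] by (simp add: mat2_eq_iff)

lemma mult_nth2:
  "(A ** B) $ i $ j = A $ i $ 1 * B $ 1 $ j + A $ i $ 2 * B $ 2 $ j"
  for A B :: "'b::semiring_1^2^2"
  by (simp add: matrix_matrix_mult_def sum_2)

lemma mat2_mult: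
  "mat2 a b c d ** mat2 a' b' c' d' =
     mat2 (a * a' + b * c') (a * b' + b * d') (c * a' + d * c') (c * b' + d * d')"
  for a :: "'b::semiring_1"
  by (simp add: mat2_eq_iff mult_nth2)

lemma mat_1_eq_mat2: "mat 1 = (mat2 1 0 0 1 :: 'b::semiring_1^2^2)"
  by (simp add: mat2_eq_iff mat_def)

lemma mat2_in_SL2_iff:
  "mat2 a b c d \<in> SL2 R \<longleftrightarrow> a \<in> R \<and> b \<in> R \<and> c \<in> R \<and> d \<in> R \<and> a * d - b * c = 1"
  by (auto simp: SL2_def matrices_over_def forall_2 det_2)

lemma SL2_mult:
  assumes "A \<in> SL2 R" "B \<in> SL2 R"
    and "\<And>x y. x \<in> R \<Longrightarrow> y \<in> R \<Longrightarrow> x + y \<in> R" "\<And>x y. x \<in> R \<Longrightarrow> y \<in> R \<Longrightarrow> x * y \<in> R"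
  shows "A ** B \<in> SL2 R"
  using assms by (auto simp: SL2_def matrices_over_def det_mul mult_nth2)

lemma SL2_inverse:
  assumes "A \<in> SL2 R" and "\<And>x. x \<in> R \<Longrightarrow> - x \<in> R"
  obtains B where "B \<in> SL2 R" "A ** B = mat 1" "B ** A = mat 1"
proof (cases A rule: mat2_cases)
  case (1 a b c d)
  show ?thesis
    by (rule that[of "mat2 d (- b) (- c) a"])
      (use assms 1 in \<open>auto simp: mat2_in_SL2_iff mat2_mult mat_1_eq_mat2 algebra_simps\<close>)
qed

lemma Ggrp_mult: "A \<in> Ggrp \<Longrightarrow> B \<in> Ggrp \<Longrightarrow> A ** B \<in> Ggrp"
  by (simp add: SL2_mult)

lemma Gam_mult: "A \<in> Gam \<Longrightarrow> B \<in> Gam \<Longrightarrow> A ** B \<in> Gam"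
  by (simp add: SL2_mult poly_ring_add poly_ring_mult)

lemma Gam_in_Ggrp: "A \<in> Gam \<Longrightarrow> A \<in> Ggrp"
  by (auto simp: SL2_def matrices_over_def)

lemma uni_in_Ggrp [simp]: "uni s \<in> Ggrp"
  by (simp add: uni_def mat2_in_SL2_iff)

lemma adiag_in_Ggrp [simp]: "adiag n \<in> Ggrp"
  by (simp add: adiag_def mat2_in_SL2_iff)

lemma Gcoset_Gam_mult:
  assumes "\<gamma> \<in> Gam"
  shows "Gcoset (\<gamma> ** g) = Gcoset g"
proof -
  obtain \<gamma>' where \<gamma>': "\<gamma>' \<in> Gam" "\<gamma>' ** \<gamma> = mat 1"
    using SL2_inverse[OF assms poly_ring_uminus] by blast
  have "Gcoset (\<delta> ** h) \<subseteq> Gcoset h" if "\<delta> \<in> Gam" for \<delta> h :: "'a fls^2^2"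
    using that Gam_mult by (force simp: Gcoset_def matrix_mul_assoc)
  from this[OF assms, of g] this[OF \<gamma>'(1), of "\<gamma> ** g"] show ?thesis
    by (simp add: matrix_mul_assoc \<gamma>'(2))
qed

lemma ract_Gcoset: "ract (Gcoset g) h = Gcoset (g ** h)"
  by (simp add: ract_def Gcoset_def image_image matrix_mul_assoc)

lemma Gcoset_eqD: "Gcoset g = Gcoset h \<Longrightarrow> \<exists>\<gamma>\<in>Gam. h = \<gamma> ** g"
proof -
  assume "Gcoset g = Gcoset h"
  moreover have "mat 1 \<in> (Gam :: ('a fls^2^2) set)"
    by (simp add: mat_1_eq_mat2 mat2_in_SL2_iff poly_ring_0 poly_ring_1)
  then have "h \<in> Gcoset h" unfolding Gcoset_def by (metis image_eqI matrix_mul_lid)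
  ultimately show ?thesis by (auto simp: Gcoset_def)
qed

section \<open>Reduction theory\<close>

text \<open>
  The bottom row \<open>(w1, w2)\<close> has norm exactly \<open>q^-k\<close>, attained at
  \<open>w1\<close>. Adding a polynomial multiple of it to the top row is division with remainder
  in the first column; the determinant then controls the second column. When \<open>k < 0\<close>,
  both new entries have norm below \<open>q^-k\<close>, and when \<open>k \<ge> 0\<close>, they
  have norm at most \<open>q^k\<close>.
\<close>

lemma top_row_reduction:
  fixes z1 :: "'a::{field,finite} fls"
  assumes det: "z1 * w2 - z2 * w1 = 1" and w: "w1 \<in> fball k" "w2 \<in> fball k" "w1 \<notin> fball (k + 1)"
  shows "\<exists>p\<in>poly_ring. z1 + p * w1 \<in> fball (k + 1) \<and> z2 + p * w2 \<in> fball (min (k + 1) (- k))"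
proof -
  from w have w1: "w1 \<noteq> 0" "fls_subdegree w1 = k" by (auto simp: fball_iff)
  obtain p where p: "p \<in> poly_ring" "- z1 / w1 - p \<in> fball 1"
    using poly_ring_approx by blast
  have "- w1 * (- z1 / w1 - p) = z1 + p * w1" using w1(1) by (simp add: field_simps)
  moreover have "- w1 * (- z1 / w1 - p) \<in> fball (k + 1)"
    using fball_mult[of "- w1" k, OF _ p(2)] w(1) by simp
  ultimately have z1: "z1 + p * w1 \<in> fball (k + 1)" by simp
  have "w1 * (z2 + p * w2) = (z1 + p * w1) * w2 - 1"
    using det by (simp add: algebra_simps)
  moreover have "(z1 + p * w1) * w2 \<in> fball (min (k + 1 + k) 0)"
    using fball_mult[OF z1 w(2)] by (rule fball_mono) simp
  moreover have "(1 :: 'a fls) \<in> fball (min (k + 1 + k) 0)"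
    by (rule fball_mono[OF one_fball]) simp
  ultimately have "w1 * (z2 + p * w2) \<in> fball (min (k + 1 + k) 0)"
    by (simp only: fball_diff)
  then have "z2 + p * w2 \<in> fball (min (k + 1 + k) 0 - k)"
    by (simp add: fball_mult_iff w1)
  then have "z2 + p * w2 \<in> fball (min (k + 1) (- k))"
    by (rule fball_mono) simp
  with z1 p show ?thesis by blast
qed

text \<open>
  Among all \<open>\<gamma> g\<close> with \<open>\<gamma>\<close> in \<open>\<Gamma>\<close>,
  choose one whose bottom row is as short as possible, of norm \<open>q^-k\<close>, and reduce the
  top row by it. If \<open>k\<close> were negative, the reduced top row would be shorter than the
  bottom row, and exchanging the rows would contradict the choice. The minimum is taken over rows
  of matrices in \<open>\<Gamma>\<close> because such a row comes with a completion to a basis.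
\<close>

lemma reduction:
  assumes g: "g \<in> Ggrp"
  obtains \<gamma> k \<kappa> where "\<gamma> \<in> Gam" "\<kappa> \<in> SL2 Oring" "g = \<gamma> ** adiag (int k) ** \<kappa>"
proof -
  define N where "N = {n. \<exists>\<gamma>\<in>Gam. (\<gamma> ** g) $ 2 $ 1 \<in> fball n \<and> (\<gamma> ** g) $ 2 $ 2 \<in> fball n}"
  obtain a b c d where gm: "g = mat2 a b c d" by (rule mat2_cases)
  from g have det: "a * d - b * c = 1" by (simp add: gm mat2_in_SL2_iff)
  have nonempty: "\<exists>n. n \<in> N"
  proof -
    obtain n1 where n1: "n1 \<le> 0" "c \<in> fball n1" using fball_absorbing by blast
    obtain n2 where n2: "n2 \<le> n1" "d \<in> fball n2" using fball_absorbing by blast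
    have "mat 1 \<in> (Gam :: ('a fls^2^2) set)"
      by (simp add: mat_1_eq_mat2 mat2_in_SL2_iff poly_ring_0 poly_ring_1)
    moreover have "c \<in> fball n2" using n1 n2 fball_mono by blast
    ultimately show ?thesis using n2
      by (auto simp: N_def gm intro!: exI[of _ n2] bexI[of _ "mat 1"])
  qed
  have bounded: "\<exists>B. \<forall>n\<in>N. n \<le> B"
  proof -
    obtain m1 where m1: "m1 \<le> 0" "a \<in> fball m1" using fball_absorbing by blast
    obtain m2 where m2: "m2 \<le> m1" "b \<in> fball m2" using fball_absorbing by blast
    obtain m3 where m3: "m3 \<le> m2" "c \<in> fball m3" using fball_absorbing by blast
    obtain m where m: "m \<le> m3" "d \<in> fball m" using fball_absorbing by blast
    have abc: "a \<in> fball m" "b \<in> fball m" "c \<in> fball m" "d \<in> fball m"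
      using m1 m2 m3 m by (auto intro: fball_mono)
    have "n \<le> - m" if n: "n \<in> N" for n
    proof (rule ccontr)
      assume "\<not> n \<le> - m"
      from n obtain \<gamma> where \<gamma>: "\<gamma> \<in> Gam" "(\<gamma> ** g) $ 2 $ 1 \<in> fball n" "(\<gamma> ** g) $ 2 $ 2 \<in> fball n"
        by (auto simp: N_def)
      obtain p q r s where \<gamma>m: "\<gamma> = mat2 p q r s" by (rule mat2_cases)
      define w1 w2 where "w1 = r * a + s * c" and "w2 = r * b + s * d"
      have w: "w1 \<in> fball n" "w2 \<in> fball n"
        using \<gamma> by (simp_all add: gm \<gamma>m mat2_mult w1_def w2_def)
      have "w1 * d - w2 * c = r * (a * d - b * c)" "w2 * a - w1 * b = s * (a * d - b * c)"
        by (simp_all add: w1_def w2_def algebra_simps)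
      then have rs: "r = w1 * d - w2 * c" "s = w2 * a - w1 * b" by (simp_all add: det)
      have "r \<in> fball (n + m)" "s \<in> fball (n + m)"
        unfolding rs by (intro fball_diff fball_mult w abc)+
      with \<open>\<not> n \<le> - m\<close> have "r \<in> fball 1" "s \<in> fball 1" by (auto elim!: fball_mono)
      with \<gamma>(1) have "r = 0" "s = 0" "p * s - q * r = 1"
        by (auto simp: \<gamma>m mat2_in_SL2_iff intro: poly_ring_Int_fball)
      then show False by simp
    qed
    then show ?thesis by blast
  qed
  obtain B where B: "\<And>n. n \<in> N \<Longrightarrow> n \<le> B" using bounded by blast
  from nonempty obtain n0 where "n0 \<in> N" by blast
  then obtain k where k: "k \<in> N" and kmin: "\<And>n. n \<in> N \<Longrightarrow> nat (B - k) \<le> nat (B - n)"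
    using ex_has_least_nat[of "\<lambda>n. n \<in> N" n0 "\<lambda>n. nat (B - n)"] by blast
  have max: "n \<le> k" if "n \<in> N" for n
    using kmin[OF that] B[OF that] B[OF k] by linarith
  from k obtain \<gamma> where \<gamma>: "\<gamma> \<in> Gam" "(\<gamma> ** g) $ 2 $ 1 \<in> fball k" "(\<gamma> ** g) $ 2 $ 2 \<in> fball k"
    by (auto simp: N_def)
  obtain z1 z2 w1 w2 where \<gamma>g: "\<gamma> ** g = mat2 z1 z2 w1 w2" by (rule mat2_cases)
  have w: "w1 \<in> fball k" "w2 \<in> fball k" using \<gamma> by (simp_all add: \<gamma>g)
  have "\<gamma> ** g \<in> Ggrp" by (rule Ggrp_mult[OF Gam_in_Ggrp[OF \<gamma>(1)] g])
  then have det': "z1 * w2 - z2 * w1 = 1" by (simp add: \<gamma>g mat2_in_SL2_iff)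
  have "k + 1 \<notin> N" using max[of "k + 1"] by auto
  then have "w1 \<notin> fball (k + 1) \<or> w2 \<notin> fball (k + 1)"
    using \<gamma>(1) by (auto simp: N_def \<gamma>g intro!: bexI[of _ \<gamma>])
  then obtain p where p: "p \<in> poly_ring"
      "z1 + p * w1 \<in> fball (min (k + 1) (- k))" "z2 + p * w2 \<in> fball (min (k + 1) (- k))"
  proof
    assume "w1 \<notin> fball (k + 1)"
    from top_row_reduction[OF det' w this] show thesis
      using that fball_mono[of _ "k + 1" "min (k + 1) (- k)"] by fastforce
  next
    assume "w2 \<notin> fball (k + 1)"
    moreover have "z2 * (- w1) - (- z1) * w2 = 1" using det' by (simp add: algebra_simps)
    ultimately obtain p where "p \<in> poly_ring" "z2 + p * w2 \<in> fball (k + 1)"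
        "- z1 + p * (- w1) \<in> fball (min (k + 1) (- k))"
      using top_row_reduction[of z2 "- w1" "- z1" w2 k] w by auto
    moreover from this(3) have "z1 + p * w1 \<in> fball (min (k + 1) (- k))"
      using fball_uminus_iff[of "z1 + p * w1"] by simp
    ultimately show thesis
      using that fball_mono[of _ "k + 1" "min (k + 1) (- k)"] by fastforce
  qed
  have uni: "uni p \<in> Gam"
    using p by (simp add: uni_def mat2_in_SL2_iff poly_ring_0 poly_ring_1)
  have ug: "uni p ** \<gamma> ** g = mat2 (z1 + p * w1) (z2 + p * w2) w1 w2"
    by (simp add: matrix_mul_assoc[symmetric] \<gamma>g uni_def mat2_mult)
  have "0 \<le> k"
  proof (rule ccontr)
    assume neg: "\<not> 0 \<le> k"
    \<comment> \<open>Exchanging the rows makes the reduced top row the new bottom row.\<close>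
    define S where "S = mat2 0 (- 1) 1 (0 :: 'a fls)"
    have "S \<in> Gam"
      by (simp add: S_def mat2_in_SL2_iff poly_ring_0 poly_ring_1 poly_ring_uminus)
    then have "S ** (uni p ** \<gamma>) \<in> Gam"
      by (intro Gam_mult uni \<gamma>(1))
    moreover have "S ** (uni p ** \<gamma>) ** g = mat2 (- w1) (- w2) (z1 + p * w1) (z2 + p * w2)"
      by (simp only: matrix_mul_assoc[symmetric, of S] ug) (simp add: S_def mat2_mult)
    ultimately have "k + 1 \<in> N"
      using p(2,3) neg by (auto simp: N_def min_def split: if_splits intro!: bexI[of _ "S ** (uni p ** \<gamma>)"])
    with max show False by force
  qed
  define \<kappa> where "\<kappa> = adiag (- k) ** (uni p ** \<gamma> ** g)"
  have \<kappa>: "\<kappa> = mat2 (tpow (- k) * (z1 + p * w1)) (tpow (- k) * (z2 + p * w2)) (tpow k * w1) (tpow k * w2)"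
    by (simp add: \<kappa>_def ug adiag_def mat2_mult)
  have "\<kappa> \<in> Ggrp"
    unfolding \<kappa>_def by (simp add: Ggrp_mult Gam_in_Ggrp \<gamma>(1) g)
  then have K: "\<kappa> \<in> SL2 Oring"
    using p(2,3) w \<open>0 \<le> k\<close>
    unfolding \<kappa> mat2_in_SL2_iff Oring_eq_fball tpow_times_fball_iff by (simp add: min_def)
  obtain \<delta> where \<delta>: "\<delta> \<in> Gam" "\<delta> ** (uni p ** \<gamma>) = mat 1"
    using SL2_inverse[OF Gam_mult[OF uni \<gamma>(1)] poly_ring_uminus] by blast
  have "adiag k ** adiag (- k) = (mat 1 :: 'a fls^2^2)"
    by (simp add: adiag_def mat2_mult mat_1_eq_mat2)
  then have "\<delta> ** adiag k ** \<kappa> = g"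
    unfolding \<kappa>_def using \<delta>(2) by (metis matrix_mul_assoc matrix_mul_lid matrix_mul_rid)
  with \<delta> K \<open>0 \<le> k\<close> show thesis
    using that[of \<delta> \<kappa> "nat k"] by simp
qed

section \<open>The height of a reduced element\<close>

lemma mat2_mult_vec: "mat2 a b c d *v x = vector [a * x $ 1 + b * x $ 2, c * x $ 1 + d * x $ 2]"
  for a :: "'b::semiring_1"
  by (simp add: vec_eq_iff forall_2 matrix_vector_mult_def sum_2)

text \<open>
  The equality of vertices says that \<open>s \<gamma> diag(t^m, 1)\<close> and \<open>diag(t^n,
  1)\<close> span the same lattice for some scalar \<open>s\<close>. Expressing the standard basis
  through either side bounds the entries of \<open>\<gamma>\<close> and of its inverse. No row or
  column of these matrices vanishes, and nonzero polynomials have degree at least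
  \<open>0\<close>: the bottom rows force \<open>s\<close> to be a unit, and the first columns
  then give \<open>m \<le> n\<close> and \<open>n \<le> m\<close>.
\<close>

lemma v_ray_unique:
  assumes \<gamma>: "\<gamma> \<in> GL2 poly_ring" and eq: "v_ray n = vact \<gamma> (v_ray m :: 'a::{field,finite} vertex)"
  shows "n = m"
proof -
  obtain \<gamma>' where inv: "\<gamma> ** \<gamma>' = mat 1" "\<gamma>' ** \<gamma> = mat 1"
      and mat: "\<gamma> \<in> matrices_over poly_ring" "\<gamma>' \<in> matrices_over poly_ring"
    using \<gamma> by (auto simp: GL2_def)
  obtain a b c d where A: "\<gamma> = mat2 a b c d" by (rule mat2_cases)
  obtain a' b' c' d' where A': "\<gamma>' = mat2 a' b' c' d'" by (rule mat2_cases)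
  let ?t = "\<lambda>n::nat. (fls_X_inv ^ n :: 'a fls)"
  let ?M = "\<lambda>n. mat2 (?t n) 0 0 1"
  have t: "?t n \<noteq> 0" "fls_subdegree (?t n) = - int n" for n
    using tpow_nonzero[of "int n", where ?'a = 'a] subdegree_tpow[of "int n", where ?'a = 'a] by simp_all
  have "(\<lambda>x. ?M n *v x) ` std_lattice \<in> v_ray n"
    by (auto simp: v_ray_def vact_def homothety_class_def intro!: imageI exI[of _ 1])
  then have "(\<lambda>x. ?M n *v x) ` std_lattice \<in> vact (\<gamma> ** ?M m) (homothety_class std_lattice)"
    unfolding eq by (simp add: v_ray_def vact_vact)
  then obtain s where s: "s \<noteq> 0" and
    lat: "(\<lambda>x. ?M n *v x) ` std_lattice = (\<lambda>x. (\<gamma> ** ?M m) *v (s *s x)) ` std_lattice"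
    by (auto simp: vact_def homothety_class_def image_image)
  define e where "e = fls_subdegree s"
  \<comment> \<open>The images of the standard basis give the columns of \<open>\<gamma>\<close> and of its inverse.\<close>
  define e1 e2 where "e1 = (vector [1, 0] :: 'a fls^2)" and "e2 = (vector [0, 1] :: 'a fls^2)"
  have std: "e1 \<in> std_lattice" "e2 \<in> std_lattice"
    by (simp_all add: e1_def e2_def std_lattice_def forall_2 Oring_eq_fball)
  have into: "s * ?t m * a \<in> fball (- int n)" "s * ?t m * c \<in> fball 0" "s * d \<in> fball 0"
  proof -
    from lat std(1) obtain y where y: "y \<in> std_lattice" "(\<gamma> ** ?M m) *v (s *s e1) = ?M n *v y"
      by blast
    then have "s * ?t m * a = ?t n * y $ 1" "s * ?t m * c = y $ 2"
      by (auto simp: A mat2_mult mat2_mult_vec e1_def vec_eq_iff forall_2 mult_ac)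
    then show "s * ?t m * a \<in> fball (- int n)" "s * ?t m * c \<in> fball 0"
      using y(1) by (auto simp: std_lattice_def forall_2 Oring_eq_fball fball_mult_iff t)
    from lat std(2) obtain y where y: "y \<in> std_lattice" "(\<gamma> ** ?M m) *v (s *s e2) = ?M n *v y"
      by blast
    then have "s * d = y $ 2"
      by (auto simp: A mat2_mult mat2_mult_vec e2_def vec_eq_iff forall_2 mult_ac)
    then show "s * d \<in> fball 0"
      using y(1) by (auto simp: std_lattice_def forall_2 Oring_eq_fball)
  qed
  have out: "?t n * a' \<in> fball (e - int m)" "?t n * c' \<in> fball e" "d' \<in> fball e"
  proof -
    have pull: "(\<gamma>' ** ?M n) *v x = ?M m *v (s *s y)" if "?M n *v x = (\<gamma> ** ?M m) *v (s *s y)" for x y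
      using arg_cong[OF that, of "\<lambda>z. \<gamma>' *v z"]
      by (simp add: matrix_vector_mul_assoc matrix_mul_assoc inv)
    from lat std(1) obtain y where y: "y \<in> std_lattice" "?M n *v e1 = (\<gamma> ** ?M m) *v (s *s y)"
      by blast
    from pull[OF y(2)] have "?t n * a' = s * (?t m * y $ 1)" "?t n * c' = s * y $ 2"
      by (auto simp: A' mat2_mult mat2_mult_vec e1_def vec_eq_iff forall_2 mult_ac)
    then show "?t n * a' \<in> fball (e - int m)" "?t n * c' \<in> fball e"
      using y(1) s by (auto simp: std_lattice_def forall_2 Oring_eq_fball fball_mult_iff t e_def)
    from lat std(2) obtain y where y: "y \<in> std_lattice" "?M n *v e2 = (\<gamma> ** ?M m) *v (s *s y)"
      by blast
    from pull[OF y(2)] have "d' = s * y $ 2"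
      by (auto simp: A' mat2_mult mat2_mult_vec e2_def vec_eq_iff forall_2 mult_ac)
    then show "d' \<in> fball e"
      using y(1) s by (auto simp: std_lattice_def forall_2 Oring_eq_fball fball_mult_iff e_def)
  qed
  have deg: "fls_subdegree x \<le> 0" if "x \<in> poly_ring" "x \<noteq> 0" for x :: "'a fls"
    using poly_ring_Int_fball[of x] that by (force simp: fball_iff)
  have "a \<in> poly_ring" "c \<in> poly_ring" "d \<in> poly_ring" "a' \<in> poly_ring" "c' \<in> poly_ring" "d' \<in> poly_ring"
    using mat by (auto simp: A A' matrices_over_def forall_2)
  note deg' = this[THEN deg]
  have nz: "a \<noteq> 0 \<or> c \<noteq> 0" "c \<noteq> 0 \<or> d \<noteq> 0" "a' \<noteq> 0 \<or> c' \<noteq> 0" "c' \<noteq> 0 \<or> d' \<noteq> 0"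
    using inv by (auto simp: A A' mat2_mult mat_1_eq_mat2 mat2_eq_iff)
  have "0 \<le> e" using nz(2) into(2,3) deg' s t[of m] by (auto simp: fball_mult_iff fball_iff e_def)
  moreover have "e \<le> 0" using nz(4) out(2,3) deg' t[of n] by (auto simp: fball_mult_iff fball_iff)
  ultimately have e: "e = 0" by simp
  have "m \<le> n" using nz(1) into(1,2) deg' s t[of m] e by (auto simp: fball_mult_iff fball_iff e_def)
  moreover have "n \<le> m" using nz(3) out(1,2) deg' t[of n] e by (auto simp: fball_mult_iff fball_iff)
  ultimately show "n = m" by simp
qed

lemma tree_height_orbit:
  assumes \<gamma>: "\<gamma> \<in> GL2 poly_ring"
  shows "tree_height (vact \<gamma> (v_ray n)) = n"
proof -
  have "tree_height (v_ray n :: 'a vertex) = n"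
    unfolding tree_height_def
  proof (rule the_equality)
    have "mat 1 \<in> GL2 (poly_ring :: 'a fls set)"
      by (auto simp: GL2_def matrices_over_def poly_ring_0 poly_ring_1 intro!: bexI[of _ "mat 1"])
        (simp_all add: mat_def poly_ring_0 poly_ring_1)
    then show "\<exists>\<gamma>\<in>GL2 poly_ring. v_ray n = vact \<gamma> (v_ray n :: 'a vertex)"
      by (metis vact_1)
  qed (auto dest: v_ray_unique)
  then show ?thesis by (simp add: tree_height_GL2[OF \<gamma>])
qed

text \<open>
  The matrices \<open>diag(t^k, t^-k)\<close> and \<open>diag(t^(2k), 1)\<close> differ by a
  scalar, and scalars fix every homothety class.
\<close>

lemma vact_adiag: "vact (adiag (int k)) (v_ray 0) = (v_ray (2 * k) :: 'a::{field,finite} vertex)"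
proof -
  let ?c = "tpow (- int k) :: 'a fls"
  have scal: "mat2 ?c 0 0 ?c *v x = ?c *s x" for x
    by (simp add: mat2_mult_vec vec_eq_iff forall_2)
  have "vact (mat2 ?c 0 0 ?c) (homothety_class std_lattice) = homothety_class std_lattice"
  proof -
    have "(*) ?c ` {d. d \<noteq> 0} = {d. d \<noteq> 0}"
    proof (intro equalityI subsetI)
      fix x :: "'a fls" assume "x \<in> {d. d \<noteq> 0}"
      then show "x \<in> (*) ?c ` {d. d \<noteq> 0}"
        by (intro image_eqI[of _ _ "tpow (int k) * x"]) (simp_all only: mult.assoc[symmetric]
            tpow_mult_minus mult_1 mem_Collect_eq mult_eq_0_iff tpow_nonzero simp_thms)
    qed (auto simp del: fls_X_power_int power_int_of_nat power_int_minus)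
    moreover have "vact (mat2 ?c 0 0 ?c) (homothety_class std_lattice) =
        (\<lambda>d. (\<lambda>x. d *s x) ` std_lattice) ` (*) ?c ` {d. d \<noteq> 0}"
      unfolding vact_def homothety_class_def setcompr_eq_image image_image scal
      by (simp only: vector_smult_assoc)
    ultimately show ?thesis
      by (simp only: homothety_class_def setcompr_eq_image)
  qed
  moreover have "adiag (int k) = mat2 (fls_X_inv ^ (2 * k)) 0 0 1 ** mat2 ?c 0 0 ?c"
  proof -
    have "tpow (int k) = fls_X_inv ^ (2 * k) * ?c"
      using tpow_add[of "int (2 * k)" "- int k", where ?'a = 'a] by (simp flip: power_int_of_nat)
    then show ?thesis by (simp add: adiag_def mat2_mult)
  qed
  ultimately show ?thesis
    by (simp add: v_ray_def vact_vact[symmetric]) (simp add: vact_1 flip: mat_1_eq_mat2)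
qed

lemma hK_reduced:
  assumes "\<gamma> \<in> Gam" "\<kappa> \<in> SL2 Oring"
  shows "hK (Gcoset (\<gamma> ** adiag (int k) ** \<kappa>)) = 2 * k"
  using assms SL2_subset_GL2
  by (auto simp: hK_Gcoset vact_SL2_Oring vact_adiag tree_height_orbit vact_vact[symmetric])

section \<open>Counting short vectors\<close>

text \<open>
  The row vector \<open>v g\<close>, with row vectors written as pairs so that sets of them can be
  products.
\<close>

definition rowmul :: "'b::semiring_1 \<times> 'b \<Rightarrow> 'b^2^2 \<Rightarrow> 'b \<times> 'b" where
  "rowmul v g = (fst v * g $ 1 $ 1 + snd v * g $ 2 $ 1, fst v * g $ 1 $ 2 + snd v * g $ 2 $ 2)"

lemma rowmul_assoc: "rowmul (rowmul v g) h = rowmul v (g ** h)"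
  by (simp add: rowmul_def mult_nth2 algebra_simps)

lemma rowmul_1 [simp]: "rowmul v (mat 1) = v"
  by (simp add: rowmul_def mat_1_eq_mat2)

text \<open>
  Coordinates of the vectors of the lattice \<open>P\<^sup>2 g\<close> that lie in the box of
  radius \<open>q^-j\<close>.
\<close>

definition short_vectors :: "int \<Rightarrow> 'a::{field,finite} fls^2^2 \<Rightarrow> ('a fls \<times> 'a fls) set" where
  "short_vectors j g = {v \<in> poly_ring \<times> poly_ring. rowmul v g \<in> fball j \<times> fball j}"

lemma rowmul_matrices_over:
  assumes "v \<in> I \<times> I" "g \<in> matrices_over R"
    and "\<And>x y. x \<in> I \<Longrightarrow> y \<in> I \<Longrightarrow> x + y \<in> I" "\<And>x y. x \<in> I \<Longrightarrow> y \<in> R \<Longrightarrow> x * y \<in> I"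
  shows "rowmul v g \<in> I \<times> I"
  using assms by (auto simp: rowmul_def matrices_over_def)

lemma short_vectors_mult_SL2_Oring:
  assumes \<kappa>: "\<kappa> \<in> SL2 Oring"
  shows "short_vectors j (g ** \<kappa>) = short_vectors j g"
proof -
  have 1: "rowmul v \<kappa> \<in> fball j \<times> fball j" if "\<kappa> \<in> SL2 Oring" "v \<in> fball j \<times> fball j" for v \<kappa>
    using that fball_mult[of _ j _ 0]
    by (intro rowmul_matrices_over[of _ _ _ "fball 0"]) (auto simp: SL2_def Oring_eq_fball fball_add)
  obtain \<kappa>' where \<kappa>': "\<kappa>' \<in> SL2 Oring" "\<kappa> ** \<kappa>' = mat 1"
    using SL2_inverse[OF \<kappa> Oring_uminus] by blast
  have "rowmul v (g ** \<kappa>) \<in> fball j \<times> fball j \<longleftrightarrow> rowmul v g \<in> fball j \<times> fball j" for v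
    using 1[OF \<kappa>, of "rowmul v g"] 1[OF \<kappa>'(1), of "rowmul v (g ** \<kappa>)"]
    by (auto simp: rowmul_assoc \<kappa>'(2) matrix_mul_assoc[symmetric])
  then show ?thesis by (simp add: short_vectors_def)
qed

lemma bij_betw_short_vectors_Gam_mult:
  assumes \<gamma>: "\<gamma> \<in> Gam"
  shows "bij_betw (\<lambda>v. rowmul v \<gamma>) (short_vectors j (\<gamma> ** g)) (short_vectors j g)"
proof -
  obtain \<gamma>' where \<gamma>': "\<gamma>' \<in> Gam" "\<gamma> ** \<gamma>' = mat 1" "\<gamma>' ** \<gamma> = mat 1"
    using SL2_inverse[OF \<gamma> poly_ring_uminus] by blast
  have "rowmul v \<delta> \<in> poly_ring \<times> poly_ring" if "\<delta> \<in> Gam" "v \<in> poly_ring \<times> poly_ring" for v :: "'a fls \<times> 'a fls" and \<delta>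
    using that by (intro rowmul_matrices_over[of _ _ _ poly_ring])
      (auto simp: SL2_def poly_ring_add poly_ring_mult)
  with \<gamma> \<gamma>' show ?thesis
    by (intro bij_betw_byWitness[where f' = "\<lambda>v. rowmul v \<gamma>'"])
      (simp_all add: short_vectors_def rowmul_assoc matrix_mul_assoc image_subset_iff)
qed

lemma short_vectors_adiag: "short_vectors j (adiag k) = supp_in (j + k) 1 \<times> supp_in (j - k) 1"
  by (auto simp: short_vectors_def adiag_def rowmul_def simp flip: poly_ring_Int_fball_eq_supp_in)

text \<open>
  Replacing \<open>g\<close> by \<open>\<gamma> g \<kappa>\<close> only changes the coordinates of
  the lattice and preserves the norm, so the reduced form decides: for \<open>diag(t^k,
  t^-k)\<close> the two coordinates are polynomials bounded independently of each other.
\<close>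

lemma hK_and_short_vectors:
  fixes g :: "'a::{field,finite} fls^2^2"
  assumes "g \<in> Ggrp"
  obtains k where "hK (Gcoset g) = 2 * k"
    and "\<And>j. finite (short_vectors j g)"
    and "\<And>j. card (short_vectors j g) = CARD('a) ^ nat (1 - j - int k) * CARD('a) ^ nat (1 - j + int k)"
proof -
  obtain \<gamma> k \<kappa> where gk: "\<gamma> \<in> Gam" "\<kappa> \<in> SL2 Oring" and g: "g = \<gamma> ** (adiag (int k) ** \<kappa>)"
    using reduction[OF assms] by (metis matrix_mul_assoc)
  have bij: "bij_betw (\<lambda>v. rowmul v \<gamma>) (short_vectors j g) (supp_in (j + int k) 1 \<times> supp_in (j - int k) 1)" for j
    using bij_betw_short_vectors_Gam_mult[OF gk(1), of j "adiag (int k) ** \<kappa>"]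
    by (simp add: g short_vectors_mult_SL2_Oring[OF gk(2)] short_vectors_adiag)
  show thesis
  proof
    show "hK (Gcoset g) = 2 * k" using hK_reduced[OF gk, of k] by (simp add: g matrix_mul_assoc)
    show "finite (short_vectors j g)" for j using bij_betw_finite[OF bij, of j] by simp
    show "card (short_vectors j g) = CARD('a) ^ nat (1 - j - int k) * CARD('a) ^ nat (1 - j + int k)" for j
      using bij_betw_same_card[OF bij, of j] by (simp add: card_cartesian_product card_supp_in algebra_simps)
  qed
qed

lemma even_hK: "g \<in> Ggrp \<Longrightarrow> even (hK (Gcoset g))"
  using hK_and_short_vectors by (metis dvd_triv_left)

text \<open>
  For \<open>j > 0\<close> the short vectors of a lattice of height \<open>2k\<close> are the
  multiples of one shortest vector by polynomials of degree at most \<open>k - j\<close>. If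
  \<open>k \<ge> j\<close>, raising \<open>j\<close> by one divides their number by
  \<open>q\<close>; if \<open>k < j\<close>, only the zero vector is left on both sides.
\<close>

lemma indicator_hK_eq_short_vectors:
  fixes g :: "'a::{field,finite} fls^2^2"
  assumes g: "g \<in> Ggrp" and j: "1 \<le> j"
  shows "(real CARD('a) - 1) * of_bool (hK (Gcoset g) < 2 * nat j) =
     real CARD('a) * real (card (short_vectors (j + 1) g)) - real (card (short_vectors j g))"
proof -
  obtain k where k: "hK (Gcoset g) = 2 * k" and
    c: "\<And>j. card (short_vectors j g) = CARD('a) ^ nat (1 - j - int k) * CARD('a) ^ nat (1 - j + int k)"
    using hK_and_short_vectors[OF g] by metis
  show ?thesis
  proof (cases "int k < j")
    case True
    then have "nat (1 - (j + 1) + int k) = 0" "nat (1 - j + int k) = 0"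
        "nat (1 - (j + 1) - int k) = 0" "nat (1 - j - int k) = 0"
      using j by auto
    moreover have "2 * k < 2 * nat j" using True by simp
    ultimately show ?thesis by (simp add: c k)
  next
    case False
    then have "nat (1 - j + int k) = Suc (nat (1 - (j + 1) + int k))"
        "nat (1 - (j + 1) - int k) = 0" "nat (1 - j - int k) = 0"
      using j by auto
    moreover have "\<not> 2 * k < 2 * nat j" using False by simp
    ultimately show ?thesis by (simp add: c k)
  qed
qed

section \<open>Continuity on the quotient\<close>

text \<open>
  The metric has base \<open>2\<close> instead of \<open>q\<close>, but the closed balls of radius
  at most \<open>1\<close> are those of the absolute value.
\<close>

lemma dist_fls_le_iff: "dist x y \<le> inverse (2 ^ n) \<longleftrightarrow> x - y \<in> fball (int n)"
proof -
  consider "x = y" | "x \<noteq> y" "0 \<le> fls_subdegree (x - y)" | "x \<noteq> y" "fls_subdegree (x - y) < 0"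
    by linarith
  then show ?thesis
  proof cases
    case 2
    then have "dist x y = inverse (2 ^ nat (fls_subdegree (x - y)))" by (simp add: dist_fls_def)
    then have "dist x y \<le> inverse (2 ^ n) \<longleftrightarrow> n \<le> nat (fls_subdegree (x - y))" by simp
    with 2 show ?thesis by (auto simp: fball_iff)
  next
    case 3
    then have "dist x y = 2 ^ nat (- fls_subdegree (x - y))" by (simp add: dist_fls_def)
    moreover have "(1::real) < 2 ^ nat (- fls_subdegree (x - y))" using 3 by simp
    moreover have "inverse (2 ^ n) \<le> (1::real)" by (simp add: inverse_le_1_iff)
    ultimately have "\<not> dist x y \<le> inverse (2 ^ n)" by linarith
    with 3 show ?thesis by (auto simp: fball_iff)
  qed simp
qed

lemma continuous_on_fls_iff:
  fixes f :: "'b::metric_space \<Rightarrow> 'a::{field,finite} fls"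
  shows "continuous_on S f \<longleftrightarrow>
    (\<forall>x\<in>S. \<forall>n::int. \<exists>d>0. \<forall>x'\<in>S. dist x' x < d \<longrightarrow> f x' - f x \<in> fball n)"
proof
  assume cont: "continuous_on S f"
  show "\<forall>x\<in>S. \<forall>n. \<exists>d>0. \<forall>x'\<in>S. dist x' x < d \<longrightarrow> f x' - f x \<in> fball n"
  proof (intro ballI allI)
    fix x n assume "x \<in> S"
    moreover have "0 < inverse (2 ^ nat n :: real)" by simp
    ultimately obtain d where d: "d > 0"
        "\<forall>x'\<in>S. dist x' x < d \<longrightarrow> dist (f x') (f x) < inverse (2 ^ nat n)"
      using cont unfolding continuous_on_iff by meson
    have "f x' - f x \<in> fball n" if "x' \<in> S" "dist x' x < d" for x'
    proof -
      have "dist (f x') (f x) \<le> inverse (2 ^ nat n)" using d(2) that by force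
      then have "f x' - f x \<in> fball (int (nat n))" by (simp only: dist_fls_le_iff)
      then show ?thesis by (rule fball_mono) simp
    qed
    with d(1) show "\<exists>d>0. \<forall>x'\<in>S. dist x' x < d \<longrightarrow> f x' - f x \<in> fball n" by blast
  qed
next
  assume *: "\<forall>x\<in>S. \<forall>n. \<exists>d>0. \<forall>x'\<in>S. dist x' x < d \<longrightarrow> f x' - f x \<in> fball n"
  show "continuous_on S f"
    unfolding continuous_on_iff
  proof (intro ballI allI impI)
    fix x and e :: real assume "x \<in> S" "e > 0"
    obtain n where n: "inverse (2 ^ n) < e"
      using real_arch_pow_inv[OF \<open>e > 0\<close>, of "1/2"] by (auto simp: power_one_over divide_simps)
    obtain d where "d > 0" "\<forall>x'\<in>S. dist x' x < d \<longrightarrow> f x' - f x \<in> fball (int n)"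
      using * \<open>x \<in> S\<close> by blast
    then show "\<exists>d>0. \<forall>x'\<in>S. dist x' x < d \<longrightarrow> dist (f x') (f x) < e"
      using n dist_fls_le_iff by (metis le_less_trans)
  qed
qed

lemma continuous_on_fls_add:
  fixes f g :: "'b::metric_space \<Rightarrow> 'a::{field,finite} fls"
  assumes "continuous_on S f" "continuous_on S g"
  shows "continuous_on S (\<lambda>x. f x + g x)"
  unfolding continuous_on_fls_iff
proof (intro ballI allI)
  fix x n assume x: "x \<in> S"
  from x obtain d1 where d1: "d1 > 0" "\<forall>x'\<in>S. dist x' x < d1 \<longrightarrow> f x' - f x \<in> fball n"
    using assms(1) unfolding continuous_on_fls_iff by meson
  from x obtain d2 where d2: "d2 > 0" "\<forall>x'\<in>S. dist x' x < d2 \<longrightarrow> g x' - g x \<in> fball n"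
    using assms(2) unfolding continuous_on_fls_iff by meson
  have "f x' + g x' - (f x + g x) \<in> fball n" if "x' \<in> S" "dist x' x < min d1 d2" for x'
    using fball_add[of "f x' - f x" n "g x' - g x"] d1 d2 that by (simp add: algebra_simps)
  then show "\<exists>d>0. \<forall>x'\<in>S. dist x' x < d \<longrightarrow> f x' + g x' - (f x + g x) \<in> fball n"
    using d1(1) d2(1) by (intro exI[of _ "min d1 d2"]) auto
qed

lemma continuous_on_fls_mult_right:
  fixes f :: "'b::metric_space \<Rightarrow> 'a::{field,finite} fls"
  assumes "continuous_on S f"
  shows "continuous_on S (\<lambda>x. f x * c)"
  unfolding continuous_on_fls_iff
proof (intro ballI allI)
  fix x n assume x: "x \<in> S"
  obtain m where m: "c \<in> fball m" using fball_absorbing by blast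
  from x obtain d where d: "d > 0" "\<forall>x'\<in>S. dist x' x < d \<longrightarrow> f x' - f x \<in> fball (n - m)"
    using assms unfolding continuous_on_fls_iff by meson
  have "f x' * c - f x * c \<in> fball n" if "x' \<in> S" "dist x' x < d" for x'
    using fball_mult[of "f x' - f x" "n - m" c m] d m that by (simp add: algebra_simps)
  with d(1) show "\<exists>d>0. \<forall>x'\<in>S. dist x' x < d \<longrightarrow> f x' * c - f x * c \<in> fball n" by blast
qed

lemma continuous_on_matrix_mult_right:
  fixes h :: "'a::{field,finite} fls^2^2" and S :: "('a fls^2^2) set"
  shows "continuous_on S (\<lambda>g. g ** h)"
proof -
  have eq: "g ** h = (\<chi> i j. g $ i $ 1 * h $ 1 $ j + g $ i $ 2 * h $ 2 $ j)" for g :: "'a fls^2^2"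
    by (simp add: vec_eq_iff mult_nth2)
  show ?thesis
    unfolding eq by (intro continuous_on_vec_lambda continuous_on_fls_add continuous_on_fls_mult_right
        continuous_on_component continuous_on_id)
qed

text \<open>
  The group \<open>K\<close> is open: \<open>g' = g \<kappa>\<close> with \<open>\<kappa> = 1 +
  g^-1 (g' - g)\<close>, which is integral when \<open>g'\<close> is close to \<open>g\<close>.
\<close>

lemma nearby_in_K_coset:
  fixes g :: "'a::{field,finite} fls^2^2"
  assumes g: "g \<in> Ggrp"
  obtains e where "e > 0" "\<And>g'. g' \<in> Ggrp \<Longrightarrow> dist g' g < e \<Longrightarrow> \<exists>\<kappa>\<in>SL2 Oring. g' = g ** \<kappa>"
proof -
  obtain a b c d where gm: "g = mat2 a b c d" by (rule mat2_cases)
  from g have det: "a * d - b * c = 1" by (simp add: gm mat2_in_SL2_iff)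
  obtain m1 where m1: "m1 \<le> 0" "a \<in> fball m1" using fball_absorbing by blast
  obtain m2 where m2: "m2 \<le> m1" "b \<in> fball m2" using fball_absorbing by blast
  obtain m3 where m3: "m3 \<le> m2" "c \<in> fball m3" using fball_absorbing by blast
  obtain m where m: "m \<le> m3" "d \<in> fball m" using fball_absorbing by blast
  have abcd: "a \<in> fball m" "b \<in> fball m" "c \<in> fball m" "d \<in> fball m"
    using m1 m2 m3 m by (auto intro: fball_mono)
  define e where "e = inverse (2 ^ nat (- m) :: real)"
  show thesis
  proof (rule that[of e])
    fix g' :: "'a fls^2^2" assume g': "g' \<in> Ggrp" and dist: "dist g' g < e"
    obtain a' b' c' d' where g'm: "g' = mat2 a' b' c' d'" by (rule mat2_cases)
    have "dist (g' $ i $ j) (g $ i $ j) \<le> e" for i j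
      using dist dist_vec_nth_le[of "g' $ i" j "g $ i"] dist_vec_nth_le[of g' i g] by linarith
    then have "g' $ i $ j - g $ i $ j \<in> fball (int (nat (- m)))" for i j
      unfolding e_def dist_fls_le_iff .
    then have "g' $ i $ j - g $ i $ j \<in> fball (- m)" for i j
      using m1 m2 m3 m by simp
    from this[of 1 1] this[of 1 2] this[of 2 1] this[of 2 2]
    have diff: "a' - a \<in> fball (- m)" "b' - b \<in> fball (- m)" "c' - c \<in> fball (- m)" "d' - d \<in> fball (- m)"
      by (simp_all add: gm g'm)
    have O: "x * y - z * w \<in> fball 0" if "x \<in> fball m" "y \<in> fball (- m)" "z \<in> fball m" "w \<in> fball (- m)"
      for x y z w :: "'a fls"
      using fball_mult[OF that(1,2)] fball_mult[OF that(3,4)] by (simp add: fball_diff)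
    define \<kappa> where "\<kappa> = mat2 d (- b) (- c) a ** g'"
    have \<kappa>: "\<kappa> = mat2 (d * (a' - a) - b * (c' - c) + 1) (d * (b' - b) - b * (d' - d))
        (a * (c' - c) - c * (a' - a)) (a * (d' - d) - c * (b' - b) + 1)"
      using det by (auto simp: \<kappa>_def g'm mat2_mult mat2_eq_iff algebra_simps)
    have "mat2 d (- b) (- c) a \<in> Ggrp" using det by (simp add: mat2_in_SL2_iff mult_ac)
    then have "\<kappa> \<in> Ggrp" unfolding \<kappa>_def using g' by (rule Ggrp_mult)
    then have "\<kappa> \<in> SL2 Oring"
      using O abcd diff unfolding \<kappa> mat2_in_SL2_iff Oring_eq_fball
      by (simp add: fball_add)
    moreover have "g ** mat2 d (- b) (- c) a = mat 1"
      using det by (simp add: gm mat2_mult mat_1_eq_mat2 mat2_eq_iff algebra_simps)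
    then have "g' = g ** \<kappa>"
      unfolding \<kappa>_def by (simp add: matrix_mul_assoc)
    ultimately show "\<exists>\<kappa>\<in>SL2 Oring. g' = g ** \<kappa>" by blast
  qed (simp add: e_def)
qed

lemma Xsp_cases:
  assumes "x \<in> Xsp" obtains g where "g \<in> Ggrp" "x = Gcoset g"
  using assms by (auto simp: Xsp_def)

lemma Gcoset_in_Xsp: "g \<in> Ggrp \<Longrightarrow> Gcoset g \<in> Xsp"
  by (simp add: Xsp_def)

lemma ract_in_Xsp: "x \<in> Xsp \<Longrightarrow> h \<in> Ggrp \<Longrightarrow> ract x h \<in> Xsp"
  by (auto elim!: Xsp_cases simp: ract_Gcoset intro!: Gcoset_in_Xsp Ggrp_mult)

text \<open>
  The height is right invariant under the open group \<open>K\<close>, hence locally constant.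
\<close>

lemma openin_hK: "openin Xtop {x \<in> Xsp. hK x \<in> S}"
  unfolding openin_Xtop openin_euclidean_subtopology_iff
proof (intro conjI ballI)
  fix g :: "'a fls^2^2" assume "g \<in> {g \<in> Ggrp. Gcoset g \<in> {x \<in> Xsp. hK x \<in> S}}"
  then have g: "g \<in> Ggrp" "hK (Gcoset g) \<in> S" by auto
  obtain e where e: "e > 0" "\<And>g'. g' \<in> Ggrp \<Longrightarrow> dist g' g < e \<Longrightarrow> \<exists>\<kappa>\<in>SL2 Oring. g' = g ** \<kappa>"
    using nearby_in_K_coset[OF g(1)] by blast
  have "hK (Gcoset g') = hK (Gcoset g)" if "g' \<in> Ggrp" "dist g' g < e" for g'
    using e(2)[OF that] hK_ract_SL2_Oring[OF Gcoset_in_Xsp[OF g(1)]] by (auto simp: ract_Gcoset)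
  with e(1) g(2) show "\<exists>e>0. \<forall>g'\<in>Ggrp. dist g' g < e \<longrightarrow> g' \<in> {g \<in> Ggrp. Gcoset g \<in> {x \<in> Xsp. hK x \<in> S}}"
    by (auto simp: Gcoset_in_Xsp)
qed auto

lemma continuous_map_ract:
  assumes h: "h \<in> Ggrp"
  shows "continuous_map Xtop Xtop (\<lambda>x. ract x h)"
  unfolding continuous_map topspace_Xtop
proof (intro conjI allI impI)
  fix V :: "'a point set" assume V: "openin Xtop V"
  then have "openin (top_of_set Ggrp) {g \<in> Ggrp. Gcoset g \<in> V}" by (simp add: openin_Xtop)
  then have "openin (top_of_set Ggrp) (Ggrp \<inter> (\<lambda>g. g ** h) -` {g \<in> Ggrp. Gcoset g \<in> V})"
    by (intro continuous_openin_preimage[OF continuous_on_matrix_mult_right]) (auto intro: Ggrp_mult h)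
  moreover have "Ggrp \<inter> (\<lambda>g. g ** h) -` {g \<in> Ggrp. Gcoset g \<in> V} =
      {g \<in> Ggrp. Gcoset g \<in> {x \<in> Xsp. ract x h \<in> V}}"
    using h by (auto simp: ract_Gcoset Gcoset_in_Xsp Ggrp_mult)
  ultimately show "openin Xtop {x \<in> Xsp. ract x h \<in> V}" by (auto simp: openin_Xtop)
qed (auto intro: ract_in_Xsp h)

lemma space_borel_on: "space (borel_on T) = topspace T"
  unfolding borel_on_def by (rule space_measure_of) (auto dest: openin_subset)

lemma borel_on_openin: "openin T V \<Longrightarrow> V \<in> sets (borel_on T)"
proof -
  assume "openin T V"
  moreover have "{V. openin T V} \<subseteq> Pow (topspace T)" by (auto dest: openin_subset)
  ultimately show ?thesis unfolding borel_on_def sets_measure_of[OF \<open>_ \<subseteq> Pow _\<close>] by blast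
qed

lemma measurable_borel_on:
  assumes "continuous_map T T' f"
  shows "f \<in> measurable (borel_on T) (borel_on T')"
  unfolding borel_on_def[of T']
proof (rule measurable_measure_of)
  fix V assume "V \<in> {V. openin T' V}"
  then have "openin T {x \<in> topspace T. f x \<in> V}"
    using assms by (simp add: continuous_map)
  then show "f -` V \<inter> space (borel_on T) \<in> sets (borel_on T)"
    by (simp add: space_borel_on Int_def conj_commute borel_on_openin)
qed (use assms in \<open>auto simp: space_borel_on continuous_map dest: openin_subset\<close>)

section \<open>The Hecke relation for short vectors\<close>

text \<open>
  Together the \<open>hecke_up r0 r1\<close> and the \<open>hecke_down r\<close> represent the
  \<open>q\<^sup>2 + q\<close> vertices at distance two from the base vertex of the tree,
  equivalently the points of the projective line over \<open>O / t^-2 O\<close>.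
\<close>

definition hecke_up :: "'a \<Rightarrow> 'a \<Rightarrow> 'a::{field,finite} fls^2^2" where
  "hecke_up r0 r1 = uni (fls_const r0 + fls_const r1 * fls_X) ** adiag (- 1)"

definition hecke_down :: "'a \<Rightarrow> 'a::{field,finite} fls^2^2" where
  "hecke_down r = mat2 1 0 (fls_const r * fls_X) 1 ** adiag 1"

lemma hecke_in_Ggrp: "hecke_up r0 r1 \<in> Ggrp" "hecke_down r \<in> Ggrp"
  unfolding hecke_up_def hecke_down_def
  by (simp_all add: Ggrp_mult mat2_in_SL2_iff)

lemma fls_times_const_nth: "(x * fls_const r) $$ n = x $$ n * r"
  for x :: "'a::{field,finite} fls"
  by (rule fls_mult_const_nth)

lemma rowmul_uni_adiag_iff:
  "rowmul (w1, w2) (uni r ** adiag k) \<in> fball j \<times> fball j \<longleftrightarrow>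
     w1 \<in> fball (j + k) \<and> w1 * r + w2 \<in> fball (j - k)"
proof -
  have "rowmul (w1, w2) (uni r ** adiag k) = (w1 * tpow k, (w1 * r + w2) * tpow (- k))"
    by (simp add: rowmul_def uni_def adiag_def mat2_mult algebra_simps)
  then show ?thesis by (simp only: mem_Times_iff fst_conv snd_conv tpow_times_fball_iff) simp
qed

lemma rowmul_lower_adiag_iff:
  "rowmul (w1, w2) (mat2 1 0 r 1 ** adiag k) \<in> fball j \<times> fball j \<longleftrightarrow>
     w1 + w2 * r \<in> fball (j + k) \<and> w2 \<in> fball (j - k)"
proof -
  have "rowmul (w1, w2) (mat2 1 0 r 1 ** adiag k) = ((w1 + w2 * r) * tpow k, w2 * tpow (- k))"
    by (simp add: rowmul_def adiag_def mat2_mult algebra_simps)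
  then show ?thesis by (simp only: mem_Times_iff fst_conv snd_conv tpow_times_fball_iff) simp
qed

lemma fls_times_const_X_nth: "(x * (fls_const r * fls_X)) $$ n = x $$ (n - 1) * r"
  for x :: "'a::{field,finite} fls"
proof -
  have "x * (fls_const r * fls_X) = fls_X * (fls_const r * x)" by (simp add: mult_ac)
  then show ?thesis by (simp add: fls_X_times_conv_shift mult.commute)
qed

text \<open>
  Once both entries lie in the ball of radius \<open>q^(1-j)\<close>, only their coefficients at
  \<open>j - 1\<close> and \<open>j\<close> matter. The condition is linear in the parameters
  \<open>r0\<close>, \<open>r1\<close>, which reduces \<open>hecke_count\<close> to linear
  equations over the finite field.
\<close>

lemma rowmul_hecke_up_iff:
  "rowmul (w1, w2) (hecke_up r0 r1) \<in> fball j \<times> fball j \<longleftrightarrow>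
     w1 \<in> fball (j - 1) \<and> w2 \<in> fball (j - 1) \<and> w1 $$ (j - 1) * r0 + w2 $$ (j - 1) = 0 \<and>
     w1 $$ (j - 1) * r1 + w1 $$ j * r0 + w2 $$ j = 0"
proof -
  let ?r = "fls_const r0 + fls_const r1 * fls_X"
  have nth: "(w1 * ?r + w2) $$ n = w1 $$ n * r0 + w1 $$ (n - 1) * r1 + w2 $$ n" for n
    by (simp only: distrib_left fls_plus_nth fls_times_const_X_nth fls_times_const_nth)
  have "rowmul (w1, w2) (hecke_up r0 r1) \<in> fball j \<times> fball j \<longleftrightarrow>
      w1 \<in> fball (j - 1) \<and> w1 * ?r + w2 \<in> fball (j + 1)"
    unfolding hecke_up_def rowmul_uni_adiag_iff by simp
  also have "\<dots> \<longleftrightarrow> w1 \<in> fball (j - 1) \<and> (w2 \<in> fball (j - 1) \<and>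
      (w1 * ?r + w2) $$ (j - 1) = 0 \<and> (w1 * ?r + w2) $$ j = 0)"
  proof (rule conj_cong[OF refl])
    assume w1: "w1 \<in> fball (j - 1)"
    then have "w1 * ?r + w2 \<in> fball (j - 1) \<longleftrightarrow> w2 \<in> fball (j - 1)"
      unfolding fball_def nth mem_Collect_eq by simp
    then show "w1 * ?r + w2 \<in> fball (j + 1) \<longleftrightarrow> w2 \<in> fball (j - 1) \<and>
      (w1 * ?r + w2) $$ (j - 1) = 0 \<and> (w1 * ?r + w2) $$ j = 0"
      using fball_Suc_iff[of "w1 * ?r + w2" "j - 1"] fball_Suc_iff[of "w1 * ?r + w2" j] by auto
  qed
  also have "\<dots> \<longleftrightarrow> w1 \<in> fball (j - 1) \<and> w2 \<in> fball (j - 1) \<and> w1 $$ (j - 1) * r0 + w2 $$ (j - 1) = 0 \<and>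
     w1 $$ (j - 1) * r1 + w1 $$ j * r0 + w2 $$ j = 0"
    unfolding nth by (auto simp: fball_def add_ac)
  finally show ?thesis .
qed

lemma rowmul_hecke_down_iff:
  "rowmul (w1, w2) (hecke_down r) \<in> fball j \<times> fball j \<longleftrightarrow>
     w1 \<in> fball (j - 1) \<and> w2 \<in> fball (j - 1) \<and> w1 $$ (j - 1) = 0 \<and> w2 $$ (j - 1) * r + w1 $$ j = 0"
proof -
  let ?y = "w1 + w2 * (fls_const r * fls_X)"
  have nth: "?y $$ n = w1 $$ n + w2 $$ (n - 1) * r" for n
    by (simp only: fls_plus_nth fls_times_const_X_nth)
  have "rowmul (w1, w2) (hecke_down r) \<in> fball j \<times> fball j \<longleftrightarrow>
      ?y \<in> fball (j + 1) \<and> w2 \<in> fball (j - 1)"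
    unfolding hecke_down_def rowmul_lower_adiag_iff by simp
  also have "\<dots> \<longleftrightarrow> w1 \<in> fball (j - 1) \<and> w2 \<in> fball (j - 1) \<and> w1 $$ (j - 1) = 0 \<and> w2 $$ (j - 1) * r + w1 $$ j = 0"
  proof (cases "w2 \<in> fball (j - 1)")
    case True
    then have y: "?y \<in> fball (j - 1) \<longleftrightarrow> w1 \<in> fball (j - 1)" "?y $$ (j - 1) = w1 $$ (j - 1)"
        "?y $$ j = w2 $$ (j - 1) * r + w1 $$ j"
      unfolding fball_def nth mem_Collect_eq by simp_all
    note Suc = fball_Suc_iff[of ?y j] fball_Suc_iff[of ?y "j - 1", unfolded diff_add_cancel]
    show ?thesis unfolding Suc y using True by blast
  qed simp
  finally show ?thesis .
qed

text \<open>
  Multiplication by one of these elements scales the norm of \<open>w\<close> by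
  \<open>q^-1\<close>, \<open>1\<close> or \<open>q\<close>. For nonzero \<open>w\<close> this
  happens for \<open>1\<close>, \<open>q - 1\<close> and \<open>q\<^sup>2\<close> elements,
  respectively. The right-hand side records this as a count of the products of norm at most
  \<open>q^-j\<close>.
\<close>

lemma hecke_count:
  fixes w :: "'a::{field,finite} fls \<times> 'a fls"
  shows "real (card {(r0, r1). rowmul w (hecke_up r0 r1) \<in> fball j \<times> fball j}) +
      real (card {r. rowmul w (hecke_down r) \<in> fball j \<times> fball j}) =
    real CARD('a) ^ 2 * of_bool (w \<in> fball (j + 1) \<times> fball (j + 1)) +
      (real CARD('a) - 1) * of_bool (w \<in> fball j \<times> fball j) +
      of_bool (w \<in> fball (j - 1) \<times> fball (j - 1))"
proof (cases "w \<in> fball (j - 1) \<times> fball (j - 1)")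
  case False
  then have "w \<notin> fball j \<times> fball j" "w \<notin> fball (j + 1) \<times> fball (j + 1)"
    by (auto elim!: fball_mono)
  moreover have "{(r0, r1). rowmul w (hecke_up r0 r1) \<in> fball j \<times> fball j} = {}"
    "{r. rowmul w (hecke_down r) \<in> fball j \<times> fball j} = {}"
    using False by (cases w; force simp: rowmul_hecke_up_iff rowmul_hecke_down_iff)+
  ultimately show ?thesis using False by simp
next
  case True
  obtain w1 w2 where w: "w = (w1, w2)" by (cases w)
  define a0 a1 b0 b1 where "a0 = w1 $$ (j - 1)" and "a1 = w1 $$ j"
    and "b0 = w2 $$ (j - 1)" and "b1 = w2 $$ j"
  let ?U = "{(r0, r1). a0 * r0 + b0 = 0 \<and> a0 * r1 + a1 * r0 + b1 = 0}"
  let ?D = "{r. a0 = 0 \<and> b0 * r + a1 = 0}"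
  have U: "{(r0, r1). rowmul w (hecke_up r0 r1) \<in> fball j \<times> fball j} = ?U"
    and D: "{r. rowmul w (hecke_down r) \<in> fball j \<times> fball j} = ?D"
    using True unfolding w rowmul_hecke_up_iff rowmul_hecke_down_iff
    by (auto simp: a0_def a1_def b0_def b1_def)
  have j: "w \<in> fball j \<times> fball j \<longleftrightarrow> a0 = 0 \<and> b0 = 0"
    "w \<in> fball (j + 1) \<times> fball (j + 1) \<longleftrightarrow> a0 = 0 \<and> b0 = 0 \<and> a1 = 0 \<and> b1 = 0"
    using True fball_Suc_iff[of w1 "j - 1"] fball_Suc_iff[of w2 "j - 1"] fball_Suc_iff[of w1 j] fball_Suc_iff[of w2 j]
    by (auto simp: w a0_def a1_def b0_def b1_def)
  consider "a0 \<noteq> 0" | "a0 = 0" "b0 \<noteq> 0" | "a0 = 0" "b0 = 0" "a1 \<noteq> 0" |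
    "a0 = 0" "b0 = 0" "a1 = 0" "b1 \<noteq> 0" | "a0 = 0" "b0 = 0" "a1 = 0" "b1 = 0" by blast
  then have "real (card ?U) + real (card ?D) =
    real CARD('a) ^ 2 * of_bool (a0 = 0 \<and> b0 = 0 \<and> a1 = 0 \<and> b1 = 0) +
      (real CARD('a) - 1) * of_bool (a0 = 0 \<and> b0 = 0) + 1"
  proof cases
    case 1
    have "?U = {(- b0 / a0, - (a1 * (- b0 / a0) + b1) / a0)}"
    proof (intro equalityI subsetI)
      fix z assume "z \<in> ?U"
      then obtain x y where z: "z = (x, y)" and e: "a0 * x + b0 = 0" "a0 * y + a1 * x + b1 = 0" by auto
      from e(1) have x: "x = - b0 / a0" using 1 by (simp add: field_simps eq_neg_iff_add_eq_0)
      have "a0 * y = - (a1 * x + b1)" using e(2) by (simp only: eq_neg_iff_add_eq_0 add.assoc)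
      then have "y = - (a1 * x + b1) / a0" using 1 by (simp add: field_simps)
      with x z show "z \<in> {(- b0 / a0, - (a1 * (- b0 / a0) + b1) / a0)}" by simp
    qed (use 1 in \<open>auto simp: field_simps\<close>)
    then have "card ?U = 1" by simp
    with 1 show ?thesis by simp
  next
    case 2
    then have "?D = {- a1 / b0}" by (auto simp: field_simps eq_neg_iff_add_eq_0)
    then have "card ?D = 1" by simp
    with 2 show ?thesis by simp
  next
    case 3
    then have "?U = {- b1 / a1} \<times> UNIV" by (auto simp: field_simps eq_neg_iff_add_eq_0)
    then have "card ?U = CARD('a)" by (simp add: card_cartesian_product)
    with 3 show ?thesis by simp
  next
    case 4
    then show ?thesis by simp
  next
    case 5
    then have "?U = UNIV \<times> UNIV" by auto
    then have "card ?U = CARD('a)\<^sup>2" by (simp only: card_cartesian_product power2_eq_square)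
    with 5 show ?thesis by simp
  qed
  with True show ?thesis unfolding U D j by simp
qed

lemma hecke_sum_short_vectors:
  fixes g :: "'a::{field,finite} fls^2^2"
  assumes g: "g \<in> Ggrp"
  shows "(\<Sum>(r0, r1)\<in>UNIV. real (card (short_vectors j (g ** hecke_up r0 r1)))) +
      (\<Sum>r\<in>UNIV. real (card (short_vectors j (g ** hecke_down r)))) =
    real CARD('a) ^ 2 * real (card (short_vectors (j + 1) g)) +
      (real CARD('a) - 1) * real (card (short_vectors j g)) + real (card (short_vectors (j - 1) g))"
proof -
  let ?S = "short_vectors (j - 1) g"
  have fin: "finite ?S" using hK_and_short_vectors[OF g] by metis
  have cnt: "real (card (short_vectors j (g ** h))) = (\<Sum>v\<in>?S. of_bool (rowmul (rowmul v g) h \<in> fball j \<times> fball j))"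
    if h: "\<And>w. rowmul w h \<in> fball j \<times> fball j \<Longrightarrow> w \<in> fball (j - 1) \<times> fball (j - 1)" for h
  proof -
    have "short_vectors j (g ** h) = {v \<in> ?S. rowmul (rowmul v g) h \<in> fball j \<times> fball j}"
    proof (rule set_eqI)
      fix v
      show "v \<in> short_vectors j (g ** h) \<longleftrightarrow> v \<in> {v \<in> ?S. rowmul (rowmul v g) h \<in> fball j \<times> fball j}"
        unfolding short_vectors_def rowmul_assoc[symmetric] mem_Collect_eq using h[of "rowmul v g"] by argo
    qed
    then show ?thesis using fin by (simp add: of_bool_def sum.If_cases Int_def)
  qed
  have up: "real (card (short_vectors j (g ** hecke_up r0 r1))) =
      (\<Sum>v\<in>?S. of_bool (rowmul (rowmul v g) (hecke_up r0 r1) \<in> fball j \<times> fball j))" for r0 r1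
    by (rule cnt) (metis rowmul_hecke_up_iff SigmaI prod.collapse)
  have down: "real (card (short_vectors j (g ** hecke_down r))) =
      (\<Sum>v\<in>?S. of_bool (rowmul (rowmul v g) (hecke_down r) \<in> fball j \<times> fball j))" for r
    by (rule cnt) (metis rowmul_hecke_down_iff SigmaI prod.collapse)
  have "(\<Sum>(r0, r1)\<in>UNIV. real (card (short_vectors j (g ** hecke_up r0 r1)))) +
      (\<Sum>r\<in>UNIV. real (card (short_vectors j (g ** hecke_down r)))) =
     (\<Sum>v\<in>?S. (\<Sum>(r0, r1)\<in>UNIV. of_bool (rowmul (rowmul v g) (hecke_up r0 r1) \<in> fball j \<times> fball j)) +
        (\<Sum>r\<in>UNIV. of_bool (rowmul (rowmul v g) (hecke_down r) \<in> fball j \<times> fball j)))"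
    unfolding up down sum.distrib case_prod_unfold by (simp only: sum.swap[of _ ?S])
  also have "\<dots> = (\<Sum>v\<in>?S. real (card {(r0, r1). rowmul (rowmul v g) (hecke_up r0 r1) \<in> fball j \<times> fball j}) +
      real (card {r. rowmul (rowmul v g) (hecke_down r) \<in> fball j \<times> fball j}))"
    by (simp add: of_bool_def sum.If_cases case_prod_unfold)
  also have "\<dots> = (\<Sum>v\<in>?S. real CARD('a) ^ 2 * of_bool (rowmul v g \<in> fball (j + 1) \<times> fball (j + 1)) +
      (real CARD('a) - 1) * of_bool (rowmul v g \<in> fball j \<times> fball j) +
      of_bool (rowmul v g \<in> fball (j - 1) \<times> fball (j - 1)))"
    unfolding hecke_count ..
  also have "\<dots> = real CARD('a) ^ 2 * (\<Sum>v\<in>?S. of_bool (rowmul v g \<in> fball (j + 1) \<times> fball (j + 1))) +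
      (real CARD('a) - 1) * (\<Sum>v\<in>?S. of_bool (rowmul v g \<in> fball j \<times> fball j)) +
      (\<Sum>v\<in>?S. of_bool (rowmul v g \<in> fball (j - 1) \<times> fball (j - 1)))"
    by (simp only: sum.distrib sum_distrib_left)
  also have "\<dots> = real CARD('a) ^ 2 * real (card (short_vectors (j + 1) g)) +
      (real CARD('a) - 1) * real (card (short_vectors j g)) + real (card (short_vectors (j - 1) g))"
  proof -
    have "(\<Sum>v\<in>?S. of_bool (rowmul v g \<in> fball i \<times> fball i)) = real (card (short_vectors i g))" if "j - 1 \<le> i" for i
    proof -
      have "short_vectors i g = {v \<in> ?S. rowmul v g \<in> fball i \<times> fball i}"
        using fball_mono[OF _ that] by (auto simp: short_vectors_def)
      then show ?thesis using fin by (simp add: of_bool_def sum.If_cases Int_def)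
    qed
    then show ?thesis by simp
  qed
  finally show ?thesis .
qed

text \<open>
  This is the relation for short vectors, rewritten for the indicators of \<open>{hK < 2j}\<close>
  by \<open>indicator_hK_eq_short_vectors\<close>. At \<open>j = 1\<close> that lemma says nothing
  about the last term, which involves \<open>W\<^sub>0\<close>. For height \<open>0\<close> there
  are \<open>q\<^sup>2\<close> vectors of norm at most \<open>1\<close> instead of the
  \<open>q\<close> multiples of a single one, and this produces the exceptional term \<open>- q
  D\<^sub>1\<close>.
\<close>

lemma hecke_sum_height:
  fixes x :: "'a::{field,finite} point"
  assumes x: "x \<in> Xsp" and j: "1 \<le> j"
  defines "q \<equiv> real CARD('a)"
  defines "D \<equiv> \<lambda>j (x :: 'a point). of_bool (hK x < 2 * j) :: real"
  shows "(\<Sum>(r0, r1)\<in>UNIV. D j (ract x (hecke_up r0 r1))) + (\<Sum>r\<in>UNIV. D j (ract x (hecke_down r))) =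
    q ^ 2 * D (j + 1) x + (q - 1) * D j x + (if j = 1 then - q * D 1 x else D (j - 1) x)"
proof -
  obtain g where g: "g \<in> Ggrp" and xg: "x = Gcoset g" using x by (rule Xsp_cases)
  define W where "W = (\<lambda>i (g :: 'a fls^2^2). real (card (short_vectors i g)))"
  have q: "q > 1" using two_le_card_field[where 'a = 'a] by (simp add: q_def)
  have D: "(q - 1) * D i (Gcoset h) = q * W (int i + 1) h - W (int i) h" if "h \<in> Ggrp" "1 \<le> i" for h i
    using indicator_hK_eq_short_vectors[OF that(1), of "int i"] that(2) by (simp add: q_def D_def W_def)
  have Dj: "(q - 1) * D j (Gcoset (g ** h)) = q * W (int j + 1) (g ** h) - W (int j) (g ** h)"
    if "h \<in> Ggrp" for h
    using D[OF Ggrp_mult[OF g that] j] .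
  let ?H = "\<lambda>f :: 'a fls^2^2 \<Rightarrow> real. (\<Sum>(r0, r1)\<in>UNIV. f (hecke_up r0 r1)) + (\<Sum>r\<in>UNIV. f (hecke_down r))"
  have H: "?H (\<lambda>h. W i (g ** h)) = q ^ 2 * W (i + 1) g + (q - 1) * W i g + W (i - 1) g" for i
    using hecke_sum_short_vectors[OF g, of i] by (simp add: W_def q_def)
  have "(q - 1) * ?H (\<lambda>h. D j (Gcoset (g ** h))) = ?H (\<lambda>h. (q - 1) * D j (Gcoset (g ** h)))"
    by (simp add: distrib_left sum_distrib_left case_prod_unfold)
  also have "\<dots> = ?H (\<lambda>h. q * W (int j + 1) (g ** h) - W (int j) (g ** h))"
    by (simp only: Dj[OF hecke_in_Ggrp(1)] Dj[OF hecke_in_Ggrp(2)])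
  also have "\<dots> = q * ?H (\<lambda>h. W (int j + 1) (g ** h)) - ?H (\<lambda>h. W (int j) (g ** h))"
    by (simp add: sum_subtractf sum_distrib_left case_prod_unfold distrib_left)
  also have "\<dots> = q\<^sup>2 * (q * W (int (j + 1) + 1) g - W (int (j + 1)) g) +
      (q - 1) * (q * W (int j + 1) g - W (int j) g) + (q * W (int j) g - W (int j - 1) g)"
    unfolding H by (simp add: algebra_simps)
  also have "\<dots> = (q - 1) * (q\<^sup>2 * D (j + 1) x + (q - 1) * D j x) + (q * W (int j) g - W (int j - 1) g)"
  proof -
    have "(q - 1) * (q\<^sup>2 * D (j + 1) x + (q - 1) * D j x) =
        q\<^sup>2 * ((q - 1) * D (j + 1) (Gcoset g)) + (q - 1) * ((q - 1) * D j (Gcoset g))"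
      by (simp add: xg algebra_simps)
    also have "\<dots> = q\<^sup>2 * (q * W (int (j + 1) + 1) g - W (int (j + 1)) g) +
        (q - 1) * (q * W (int j + 1) g - W (int j) g)"
      using j by (simp only: D[OF g j] D[OF g, of "j + 1"] le_add2)
    finally show ?thesis by simp
  qed
  also have "q * W (int j) g - W (int j - 1) g = (q - 1) * (if j = 1 then - q * D 1 x else D (j - 1) x)"
  proof (cases "j = 1")
    case True
    obtain k where k: "hK (Gcoset g) = 2 * k" and
      c: "\<And>j. card (short_vectors j g) = CARD('a) ^ nat (1 - j - int k) * CARD('a) ^ nat (1 - j + int k)"
      using hK_and_short_vectors[OF g] by metis
    show ?thesis
    proof (cases "k = 0")
      case True
      then show ?thesis using \<open>j = 1\<close> by (simp add: W_def c xg D_def k q_def algebra_simps power2_eq_square)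
    next
      case False
      then have "nat (1 - int k) = 0" "nat (1 + int k) = Suc k" by auto
      with False show ?thesis using \<open>j = 1\<close> by (simp add: W_def c xg D_def k q_def)
    qed
  next
    case False
    with j show ?thesis using D[OF g, of "j - 1"] by (simp add: xg of_nat_diff)
  qed
  finally have "(q - 1) * ?H (\<lambda>h. D j (Gcoset (g ** h))) = (q - 1) *
      (q ^ 2 * D (j + 1) x + (q - 1) * D j x + (if j = 1 then - q * D 1 x else D (j - 1) x))"
    by (simp only: distrib_left)
  then show ?thesis using q by (simp add: xg ract_Gcoset)
qed

section \<open>The height under the invariant measure\<close>

text \<open>
  Integrating \<open>hecke_sum_height\<close> gives a linear recursion that determines all
  \<open>d j = \<mu>(hK < 2j)\<close> from \<open>d 1\<close>, so they are proportional to the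
  solution \<open>1 - q^(1-2j)\<close>. Both sequences tend to \<open>1\<close>, hence the factor
  of proportionality is \<open>1\<close>.
\<close>

lemma invariant_prob_X_height:
  fixes \<mu> :: "'a::{field,finite} point measure"
  assumes inv: "invariant_prob_X \<mu>" and j: "1 \<le> j"
  shows "measure \<mu> {x \<in> Xsp. hK x < 2 * j} = 1 - real CARD('a) * (1 / real CARD('a) ^ 2) ^ j"
proof -
  interpret prob_space \<mu> using inv by (simp add: invariant_prob_X_def)
  have sp: "space \<mu> = Xsp" and sets: "sets \<mu> = sets (borel_on Xtop)"
    and distr: "\<And>g. g \<in> Ggrp \<Longrightarrow> distr \<mu> \<mu> (\<lambda>x. ract x g) = \<mu>"
    using inv by (auto simp: invariant_prob_X_def)
  define q where "q = real CARD('a)"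
  have q: "q > 1" using two_le_card_field[where 'a = 'a] by (simp add: q_def)
  define D where "D = (\<lambda>j (x :: 'a point). of_bool (hK x < 2 * j) :: real)"
  define d where "d = (\<lambda>j. \<integral>x. D j x \<partial>\<mu>)"
  have meas_set: "{x \<in> Xsp. hK x \<in> S} \<in> events" for S
    by (simp add: sets borel_on_openin openin_hK)
  have D_ind: "(\<integral>x. D j x \<partial>\<mu>) = (\<integral>x. indicator {x \<in> Xsp. hK x < 2 * j} x \<partial>\<mu>)" for j
    by (intro Bochner_Integration.integral_cong) (auto simp: D_def sp)
  have d: "d j = prob {x \<in> Xsp. hK x < 2 * j}" for j
    using meas_set[of "{..<2 * j}"] by (simp add: d_def D_ind)
  have D_meas [measurable]: "D j \<in> borel_measurable \<mu>" for j
  proof -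
    have "indicator {x \<in> Xsp. hK x < 2 * j} \<in> borel_measurable \<mu>"
      using meas_set[of "{..<2 * j}"] by simp
    moreover have "D j \<in> borel_measurable \<mu> \<longleftrightarrow>
        (indicator {x \<in> Xsp. hK x < 2 * j} :: _ \<Rightarrow> real) \<in> borel_measurable \<mu>"
      by (rule measurable_cong) (auto simp: D_def sp)
    ultimately show ?thesis by simp
  qed
  have act_meas [measurable]: "(\<lambda>x. ract x h) \<in> measurable \<mu> \<mu>" if "h \<in> Ggrp" for h
    using measurable_borel_on[OF continuous_map_ract[OF that]] by (simp add: sets cong: measurable_cong_sets)
  have int_D: "integrable \<mu> (\<lambda>x. D j (ract x h))" if "h \<in> Ggrp" for j h
    by (rule integrable_const_bound[where B = 1, OF _ measurable_compose[OF act_meas[OF that] D_meas]])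
      (auto simp: D_def)
  have int_D': "integrable \<mu> (D j)" for j
    by (rule integrable_const_bound[where B = 1, OF _ D_meas]) (auto simp: D_def)
  have D_inv: "(\<integral>x. D j (ract x h) \<partial>\<mu>) = d j" if "h \<in> Ggrp" for j h
    using integral_distr[OF act_meas[OF that] D_meas[of j]] by (simp add: distr[OF that] d_def)
  have rec: "(q ^ 2 + q) * d j = q ^ 2 * d (j + 1) + (q - 1) * d j + (if j = 1 then - q * d 1 else d (j - 1))"
    if j: "1 \<le> j" for j
  proof -
    have "(q ^ 2 + q) * d j = (\<Sum>(r0 :: 'a, r1 :: 'a)\<in>UNIV. d j) + (\<Sum>r\<in>(UNIV :: 'a set). d j)"
    proof -
      have "card (UNIV :: ('a \<times> 'a) set) = CARD('a)\<^sup>2"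
        by (simp only: UNIV_Times_UNIV[symmetric] card_cartesian_product power2_eq_square)
      then show ?thesis by (simp add: q_def case_prod_unfold algebra_simps)
    qed
    also have "\<dots> = (\<Sum>(r0 :: 'a, r1)\<in>UNIV. \<integral>x. D j (ract x (hecke_up r0 r1)) \<partial>\<mu>) +
        (\<Sum>r\<in>UNIV. \<integral>x. D j (ract x (hecke_down r)) \<partial>\<mu>)"
      by (simp add: D_inv hecke_in_Ggrp)
    also have "\<dots> = (\<integral>x. (\<Sum>(r0, r1)\<in>UNIV. D j (ract x (hecke_up r0 r1))) +
        (\<Sum>r\<in>UNIV. D j (ract x (hecke_down r))) \<partial>\<mu>)"
      by (simp add: case_prod_unfold int_D hecke_in_Ggrp)
    also have "\<dots> = (\<integral>x. q ^ 2 * D (j + 1) x + (q - 1) * D j x + (if j = 1 then - q * D 1 x else D (j - 1) x) \<partial>\<mu>)"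
      unfolding D_def q_def
      by (rule Bochner_Integration.integral_cong[OF refl], rule hecke_sum_height[OF _ j]) (simp add: sp)
    also have "\<dots> = q ^ 2 * d (j + 1) + (q - 1) * d j + (if j = 1 then - q * d 1 else d (j - 1))"
      by (simp add: int_D' d_def)
    finally show ?thesis .
  qed
  \<comment> \<open>The recursion is linear, \<open>e\<close> is a solution, and \<open>c\<close> adjusts its initial value \<open>e 1 = (q - 1) / q\<close> to \<open>d 1\<close>.\<close>
  define c where "c = d 1 * q / (q - 1)"
  define e where "e = (\<lambda>j::nat. 1 - q * (1 / q ^ 2) ^ j)"
  have e_rec: "(q ^ 2 + q) * e j = q ^ 2 * e (j + 1) + (q - 1) * e j + (if j = 1 then - q * e 1 else e (j - 1))"
    if "1 \<le> j" for j
  proof (cases "j = 1")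
    case True
    then show ?thesis using q by (simp add: e_def field_simps power2_eq_square)
  next
    case False
    with that obtain i where i: "j = Suc i" by (cases j) auto
    show ?thesis using q False unfolding i by (simp add: e_def field_simps power2_eq_square)
  qed
  have d_eq: "d j = c * e j \<and> d (j + 1) = c * e (j + 1)" if "1 \<le> j" for j
    using that
  proof (induction j rule: dec_induct)
    case base
    have e1: "e 1 = (q - 1) / q" using q by (simp add: e_def field_simps power2_eq_square)
    then have 1: "d 1 = c * e 1" using q by (simp add: c_def)
    have "q ^ 2 * d (1 + 1) = (q ^ 2 + q) * d 1 - (q - 1) * d 1 + q * d 1"
      using rec[of 1] by simp
    also have "\<dots> = c * ((q ^ 2 + q) * e 1 - (q - 1) * e 1 + q * e 1)"
      unfolding 1 by (simp add: algebra_simps)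
    also have "\<dots> = q ^ 2 * (c * e (1 + 1))"
      using e_rec[of 1] by simp
    finally have "d (1 + 1) = c * e (1 + 1)" using q by simp
    with 1 show ?case by blast
  next
    case (step n)
    have "q ^ 2 * d (Suc n + 1) = (q ^ 2 + q) * d (Suc n) - (q - 1) * d (Suc n) - d n"
      using rec[of "Suc n"] step.hyps by simp
    also have "\<dots> = c * ((q ^ 2 + q) * e (Suc n) - (q - 1) * e (Suc n) - e n)"
      using step.IH by (simp add: algebra_simps)
    also have "\<dots> = q ^ 2 * (c * e (Suc n + 1))"
      using e_rec[of "Suc n"] step.hyps by simp
    finally have "d (Suc n + 1) = c * e (Suc n + 1)" using q by simp
    then show ?case using step.IH by simp
  qed
  have "d \<longlonglongrightarrow> 1"
  proof -
    have "(\<lambda>j. prob {x \<in> Xsp. hK x < 2 * j}) \<longlonglongrightarrow> prob (\<Union>j. {x \<in> Xsp. hK x < 2 * j})"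
      by (rule finite_Lim_measure_incseq)
        (use meas_set[of "{..<2 * _}"] in \<open>auto simp: incseq_def\<close>)
    moreover have "(\<Union>j. {x \<in> Xsp. hK x < 2 * j}) = space \<mu>"
    proof -
      have "\<exists>j. hK x < 2 * j" for x :: "'a point" by (rule exI[of _ "Suc (hK x)"]) simp
      then show ?thesis by (auto simp: sp)
    qed
    moreover have "d = (\<lambda>j. prob {x \<in> Xsp. hK x < 2 * j})" by (rule ext) (rule d)
    ultimately show ?thesis by (simp only: prob_space)
  qed
  moreover have "d \<longlonglongrightarrow> c"
  proof -
    have "(\<lambda>j. c * e j) \<longlonglongrightarrow> c * (1 - q * 0)"
      unfolding e_def by (intro tendsto_intros LIMSEQ_power_zero) (use q in simp)
    then have "(\<lambda>j. c * e j) \<longlonglongrightarrow> c" by simp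
    then show ?thesis
      by (rule Lim_transform_eventually) (use d_eq in \<open>auto simp: eventually_sequentially intro!: exI[of _ 1]\<close>)
  qed
  ultimately have "c = 1" using LIMSEQ_unique by blast
  with d_eq[OF j] show ?thesis by (simp add: d e_def q_def)
qed

section \<open>Compact unipotent orbits\<close>

definition torus :: "'a::{field,finite} fls \<Rightarrow> 'a fls^2^2" where
  "torus a = mat2 a 0 0 (inverse a)"

lemma torus_in_Ggrp [simp]: "a \<noteq> 0 \<Longrightarrow> torus a \<in> Ggrp"
  by (simp add: torus_def mat2_in_SL2_iff)

lemma torus_uni: "a \<noteq> 0 \<Longrightarrow> torus a ** uni s = uni (a\<^sup>2 * s) ** torus a"
  by (simp add: torus_def uni_def mat2_mult mat2_eq_iff power2_eq_square field_simps)

lemma Uorbit_shift: "Uorbit (ract x (uni r)) = Uorbit x"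
proof -
  have "Uorbit (ract x (uni r)) = (\<lambda>s. ract x (uni s)) ` range (\<lambda>s. r + s)"
    by (simp only: Uorbit_def ract_ract uni_mult image_image)
  also have "range (\<lambda>s. r + s) = UNIV" by (rule surj_plus)
  finally show ?thesis by (simp add: Uorbit_def)
qed

text \<open>
  The sets \<open>{hK < i}\<close> form an increasing open cover.
\<close>

lemma compact_Uorbit_bounded:
  fixes Y :: "'a::{field,finite} point set"
  assumes "compactin Xtop Y"
  obtains B where "\<And>y. y \<in> Y \<Longrightarrow> hK y < B"
proof -
  let ?U = "\<lambda>i::nat. {x \<in> Xsp :: 'a point set. hK x \<in> {..<i}}"
  have "Y \<subseteq> \<Union>(range ?U)"
    using compactin_subset_topspace[OF assms] by (auto simp: topspace_Xtop)
  moreover have "\<forall>U\<in>range ?U. openin Xtop U" using openin_hK by blast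
  ultimately obtain F where F: "finite F" "F \<subseteq> range ?U" "Y \<subseteq> \<Union>F"
    using assms unfolding compactin_def by meson
  then obtain C where C: "finite C" "F = ?U ` C" by (meson finite_subset_image)
  obtain B where B: "\<forall>i\<in>C. i < B" using C(1) finite_nat_set_iff_bounded by blast
  have "hK y < B" if "y \<in> Y" for y
    using that F(3) B unfolding C(2) by fastforce
  then show thesis by (rule that)
qed

text \<open>
  Let \<open>B\<close> bound the height on the orbit of \<open>g\<close>, and let \<open>j >
  B\<close>. The lattice of \<open>g diag(t^j, t^-j)\<close> has a vector of norm at most
  \<open>1\<close>, so the lattice of \<open>g\<close> has a vector \<open>(w1, w2)\<close> with
  \<open>w1\<close> of absolute value at most \<open>q^-j\<close>, and it is the bottom row of
  some \<open>\<gamma> g\<close>. If \<open>w1\<close> were nonzero, some \<open>u(s)\<close>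
  would carry it to \<open>(w1, 0)\<close>, and that point of the orbit would have height at least
  \<open>2j\<close>. So \<open>w1 = 0\<close> and \<open>\<gamma> g\<close> is upper triangular.
\<close>

lemma compact_Uorbit_cusp:
  fixes Y :: "'a::{field,finite} point set"
  assumes "compact_Uorbit Y"
  obtains a where "a \<noteq> 0" "Y = Uorbit (Gcoset (torus a))"
proof -
  from assms obtain g where g: "g \<in> Ggrp" and Y: "Y = Uorbit (Gcoset g)" and "compactin Xtop Y"
    by (auto simp: compact_Uorbit_def)
  then obtain B where B: "\<And>y. y \<in> Y \<Longrightarrow> hK y < B" using compact_Uorbit_bounded by blast
  define j where "j = B + 1"
  obtain \<gamma> k \<kappa> where \<gamma>: "\<gamma> \<in> Gam" and \<kappa>: "\<kappa> \<in> SL2 Oring" and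
    red: "g ** adiag (int j) = \<gamma> ** adiag (int k) ** \<kappa>"
    using reduction[OF Ggrp_mult[OF g adiag_in_Ggrp]] by metis
  obtain \<gamma>' where \<gamma>': "\<gamma>' \<in> Gam" "\<gamma>' ** \<gamma> = mat 1"
    using SL2_inverse[OF \<gamma> poly_ring_uminus] by blast
  obtain z1 z2 w1 w2 where h: "\<gamma>' ** g = mat2 z1 z2 w1 w2" by (rule mat2_cases)
  have hG: "\<gamma>' ** g \<in> Ggrp" by (rule Ggrp_mult[OF Gam_in_Ggrp[OF \<gamma>'(1)] g])
  then have det: "z1 * w2 - z2 * w1 = 1" by (simp add: h mat2_in_SL2_iff)
  have "\<gamma>' ** (g ** adiag (int j)) = adiag (int k) ** \<kappa>"
    by (simp add: red matrix_mul_assoc \<gamma>'(2))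
  then have eq: "mat2 z1 z2 w1 w2 ** adiag (int j) = adiag (int k) ** \<kappa>"
    by (simp add: matrix_mul_assoc h)
  obtain k1 k2 k3 k4 where km: "\<kappa> = mat2 k1 k2 k3 k4" by (rule mat2_cases)
  have "w1 * tpow (int j) = tpow (- int k) * k3"
    using arg_cong[OF eq, of "\<lambda>A. A $ 2 $ 1"] by (simp add: adiag_def mat2_mult km)
  moreover have "tpow (- int k) * k3 \<in> fball 0"
    unfolding tpow_times_fball_iff using \<kappa> by (auto simp: km mat2_in_SL2_iff Oring_eq_fball intro: fball_mono)
  ultimately have w1: "w1 \<in> fball (int j)"
    using tpow_times_fball_iff(2)[of w1 "int j" 0] by simp
  have "w1 = 0"
  proof (rule ccontr)
    assume "w1 \<noteq> 0"
    \<comment> \<open>The translate by \<open>u(s)\<close> makes the second entry of the vector vanish.\<close>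
    define s where "s = - w2 / w1"
    define g' where "g' = \<gamma>' ** g ** uni s"
    have g': "g' \<in> Ggrp" unfolding g'_def by (rule Ggrp_mult[OF hG uni_in_Ggrp])
    have "rowmul (0, 1) g' = (w1, 0)"
      using \<open>w1 \<noteq> 0\<close> by (simp add: g'_def h uni_def mat2_mult rowmul_def s_def)
    then have sub: "{(0, 0), (0, 1)} \<subseteq> short_vectors (int j) g'"
      using w1 by (auto simp: short_vectors_def poly_ring_0 poly_ring_1) (simp_all add: rowmul_def)
    obtain i where i: "hK (Gcoset g') = 2 * i" and fin: "finite (short_vectors (int j) g')" and
      c: "card (short_vectors (int j) g') = CARD('a) ^ nat (1 - int j - int i) * CARD('a) ^ nat (1 - int j + int i)"
      using hK_and_short_vectors[OF g'] by metis
    have "card {(0, 0), (0, 1 :: 'a fls) :: 'a fls \<times> 'a fls} \<le> card (short_vectors (int j) g')"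
      by (rule card_mono[OF fin sub])
    then have "2 \<le> card (short_vectors (int j) g')" by simp
    moreover have "nat (1 - int j - int i) = 0" by (simp add: j_def)
    ultimately have "nat (1 - int j + int i) \<noteq> 0" unfolding c by (intro notI) simp
    then have "j \<le> i" by simp
    moreover have "Gcoset g' = ract (Gcoset g) (uni s)"
      by (simp add: g'_def ract_Gcoset Gcoset_Gam_mult[OF \<gamma>'(1)] flip: matrix_mul_assoc)
    then have "hK (Gcoset g') < B" using B by (simp add: Y Uorbit_def)
    ultimately show False by (simp add: i j_def)
  qed
  with det have "z1 * w2 = 1" by simp
  then have z1: "z1 \<noteq> 0" "w2 = inverse z1" by (auto simp: inverse_unique)
  then have "\<gamma>' ** g = torus z1 ** uni (z2 / z1)"
    using \<open>w1 = 0\<close> by (simp add: h torus_def uni_def mat2_mult)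
  then have "Gcoset g = ract (Gcoset (torus z1)) (uni (z2 / z1))"
    by (metis Gcoset_Gam_mult \<gamma>'(1) ract_Gcoset)
  with z1 Y show thesis by (intro that[of z1]) (simp_all add: Uorbit_shift)
qed

lemma stabU_torus:
  assumes a: "a \<noteq> 0"
  shows "stabU (Uorbit (Gcoset (torus a))) = {s. a\<^sup>2 * s \<in> poly_ring}"
proof -
  have "Gcoset (torus a ** uni s) = Gcoset (torus a) \<longleftrightarrow> a\<^sup>2 * s \<in> poly_ring" for s
  proof
    assume "a\<^sup>2 * s \<in> poly_ring"
    then have "uni (a\<^sup>2 * s) \<in> Gam"
      by (simp add: uni_def mat2_in_SL2_iff poly_ring_0 poly_ring_1)
    then show "Gcoset (torus a ** uni s) = Gcoset (torus a)"
      by (simp add: torus_uni[OF a] Gcoset_Gam_mult)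
  next
    assume "Gcoset (torus a ** uni s) = Gcoset (torus a)"
    then obtain \<gamma> where \<gamma>: "\<gamma> \<in> Gam" "torus a ** uni s = \<gamma> ** torus a"
      using Gcoset_eqD by metis
    obtain p q r t where \<gamma>m: "\<gamma> = mat2 p q r t" by (rule mat2_cases)
    from arg_cong[OF \<gamma>(2), of "\<lambda>A. A $ 1 $ 2"] have "a * s = q * inverse a"
      by (simp add: torus_def uni_def \<gamma>m mat2_mult)
    then have "a\<^sup>2 * s = q" using a by (simp add: power2_eq_square field_simps)
    with \<gamma>(1) show "a\<^sup>2 * s \<in> poly_ring" by (simp add: \<gamma>m mat2_in_SL2_iff)
  qed
  then show ?thesis by (simp add: stabU_Uorbit ract_Gcoset)
qed

section \<open>Haar measure and the covolume of the stabilizer\<close>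

lemma fball_borel: "fball n \<in> sets borel"
proof -
  have "open (fball n :: 'a::{field,finite} fls set)"
    unfolding open_dist
  proof (intro ballI exI conjI allI impI)
    fix x y :: "'a fls" assume x: "x \<in> fball n" and "dist y x < inverse (2 ^ nat n)"
    then have "y - x \<in> fball (int (nat n))" by (simp only: dist_fls_le_iff[symmetric] less_imp_le)
    then have "y - x \<in> fball n" by (rule fball_mono) simp
    from fball_add[OF this x] show "y \<in> fball n" by simp
  qed simp
  then show ?thesis by simp
qed

lemma measurable_fls_add [measurable]: "(\<lambda>x. c + x) \<in> borel_measurable borel"
  for c :: "'a::{field,finite} fls"
  by (intro borel_measurable_continuous_onI continuous_on_fls_add continuous_on_const continuous_on_id)

lemma normalized_haar_translate:
  assumes "normalized_haar ds" "A \<in> sets borel"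
  shows "emeasure ds {x. c + x \<in> A} = emeasure ds A"
proof -
  have s: "sets ds = sets borel" and d: "distr ds ds (\<lambda>x. c + x) = ds"
    using assms(1) by (auto simp: normalized_haar_def)
  have "(\<lambda>x. c + x) \<in> measurable ds ds"
    using measurable_fls_add by (simp add: s cong: measurable_cong_sets)
  then have "emeasure (distr ds ds (\<lambda>x. c + x)) A = emeasure ds ((\<lambda>x. c + x) -` A \<inter> space ds)"
    using assms(2) by (simp add: emeasure_distr s)
  moreover have "space ds = UNIV" using sets_eq_imp_space_eq[OF s] by simp
  ultimately show ?thesis by (simp add: d vimage_def)
qed

lemma sets_translate: "A \<in> sets borel \<Longrightarrow> {x. c + x \<in> A} \<in> sets borel"
  for c :: "'a::{field,finite} fls"
  using measurable_sets[OF measurable_fls_add, of A c] by (simp add: vimage_def)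

text \<open>
  The larger ball is the disjoint union of the translates of the smaller one by the series
  supported on \<open>[l, h)\<close>.
\<close>

lemma emeasure_fball_split:
  fixes ds :: "'a::{field,finite} fls measure"
  assumes haar: "normalized_haar ds" and "l \<le> h"
  shows "emeasure ds (fball l) = of_nat (CARD('a) ^ nat (h - l)) * emeasure ds (fball h)"
proof -
  have s: "sets ds = sets borel" using haar by (simp add: normalized_haar_def)
  let ?A = "\<lambda>r :: 'a fls. {x. - r + x \<in> fball h}"
  have "(fball l :: 'a fls set) = (\<Union>r\<in>supp_in l h. ?A r)"
  proof (intro equalityI subsetI)
    fix x :: "'a fls" assume "x \<in> fball l"
    then have "- trunc l h x + x \<in> fball h" by (auto simp: fball_def)
    then show "x \<in> (\<Union>r\<in>supp_in l h. ?A r)" using trunc_in_supp_in by blast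
  next
    fix x :: "'a fls" assume "x \<in> (\<Union>r\<in>supp_in l h. ?A r)"
    then obtain r where r: "r \<in> supp_in l h" "- r + x \<in> fball h" by blast
    have "- r + x \<in> fball l" using r(2) \<open>l \<le> h\<close> by (rule fball_mono)
    moreover have "r \<in> fball l" using r(1) by (simp add: supp_in_def fball_def)
    ultimately have "r \<in> fball l" "- r + x \<in> fball l" by simp_all
    from fball_add[OF this] show "x \<in> fball l" by simp
  qed
  moreover have "disjoint_family_on ?A (supp_in l h)"
    unfolding disjoint_family_on_def
  proof (intro ballI impI)
    fix r r' :: "'a fls" assume r: "r \<in> supp_in l h" "r' \<in> supp_in l h" "r \<noteq> r'"
    have False if "- r + x \<in> fball h" "- r' + x \<in> fball h" for x
    proof -
      from fball_diff[OF that] have "r' - r \<in> fball h" by simp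
      then have "r = r'"
        using r by (intro fls_eqI) (metis (mono_tags, lifting) eq_iff_diff_eq_0 fball_def fls_minus_nth mem_Collect_eq not_le supp_in_def)
      with r show False by simp
    qed
    then show "?A r \<inter> ?A r' = {}" by blast
  qed
  moreover have "?A r \<in> sets ds" for r
    unfolding s by (rule sets_translate[OF fball_borel])
  ultimately have "emeasure ds (fball l) = (\<Sum>r\<in>supp_in l h. emeasure ds (?A r))"
    by (simp add: sum_emeasure[symmetric] image_subset_iff)
  also have "\<dots> = (\<Sum>r\<in>(supp_in l h :: 'a fls set). emeasure ds (fball h))"
    by (simp only: normalized_haar_translate[OF haar fball_borel])
  finally show ?thesis by (simp add: card_supp_in)
qed

lemma emeasure_fball:
  fixes ds :: "'a::{field,finite} fls measure"
  assumes haar: "normalized_haar ds"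
  shows "emeasure ds (fball n) = ennreal (real CARD('a) powi (- n))"
proof -
  have one: "emeasure ds (fball 0) = 1" using haar by (simp add: normalized_haar_def Oring_eq_fball)
  have q: "real CARD('a) > 0" using two_le_card_field[where 'a = 'a] by simp
  show ?thesis
  proof (cases "n \<le> 0")
    case True
    then show ?thesis
      using emeasure_fball_split[OF haar True] by (simp add: one power_int_def ennreal_of_nat_eq_real_of_nat)
  next
    case False
    then have eq: "1 = of_nat (CARD('a) ^ nat n) * emeasure ds (fball n)"
      using emeasure_fball_split[OF haar, of 0 n] by (simp add: one)
    show ?thesis
    proof (cases "emeasure ds (fball n)")
      case (real r)
      then have "ennreal (real (CARD('a) ^ nat n) * r) = ennreal 1"
        using eq by (simp add: ennreal_of_nat_eq_real_of_nat ennreal_mult)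
      then have "real (CARD('a) ^ nat n) * r = 1" using real by (subst (asm) ennreal_inj) simp_all
      then have "r = real CARD('a) powi (- n)" using False q by (simp add: power_int_def field_simps)
      then show ?thesis using real by simp
    next
      case top
      then show ?thesis using eq q by (simp add: ennreal_mult_top)
    qed
  qed
qed

text \<open>
  Cut \<open>D\<close> into the pieces that lie in the translates of \<open>D'\<close>; moved back
  by the corresponding lattice elements, the pieces make up \<open>D'\<close>.
\<close>

lemma fundamental_domain_emeasure_eq:
  assumes haar: "normalized_haar ds" and cnt: "countable \<Lambda>" and sym: "\<And>l. l \<in> \<Lambda> \<Longrightarrow> - l \<in> \<Lambda>"
    and D: "fundamental_domain \<Lambda> D" and D': "fundamental_domain \<Lambda> D'"
  shows "emeasure ds D = emeasure ds D'"
proof -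
  have s: "sets ds = sets borel" using haar by (simp add: normalized_haar_def)
  have DD: "D \<in> sets borel" "\<And>x. \<exists>!l. l \<in> \<Lambda> \<and> x - l \<in> D" and
    DD': "D' \<in> sets borel" "\<And>x. \<exists>!l. l \<in> \<Lambda> \<and> x - l \<in> D'"
    using D D' by (auto simp: fundamental_domain_def)
  let ?A = "\<lambda>l. D \<inter> {x. - l + x \<in> D'}" and ?A' = "\<lambda>l. D' \<inter> {x. l + x \<in> D}"
  have meas: "?A l \<in> sets borel" "?A' l \<in> sets borel" for l
    by (intro sets.Int sets_translate DD(1) DD'(1))+
  have "D = (\<Union>l\<in>\<Lambda>. ?A l)"
  proof (intro equalityI subsetI)
    fix x assume "x \<in> D"
    moreover obtain l where "l \<in> \<Lambda>" "x - l \<in> D'" using DD'(2) by blast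
    ultimately show "x \<in> (\<Union>l\<in>\<Lambda>. ?A l)" by auto
  qed auto
  moreover have "disjoint_family_on ?A \<Lambda>"
    using DD'(2) by (auto simp: disjoint_family_on_def)
  ultimately have 1: "emeasure ds D = (\<integral>\<^sup>+ l. emeasure ds (?A l) \<partial>count_space \<Lambda>)"
    using emeasure_UN_countable[of \<Lambda> ?A ds] cnt meas(1) by (simp add: s)
  have "D' = (\<Union>l\<in>\<Lambda>. ?A' l)"
  proof (intro equalityI subsetI)
    fix x assume "x \<in> D'"
    moreover obtain l where "l \<in> \<Lambda>" "x - l \<in> D" using DD(2) by blast
    ultimately show "x \<in> (\<Union>l\<in>\<Lambda>. ?A' l)" using sym by (auto intro!: bexI[of _ "- l"])
  qed auto
  moreover have "disjoint_family_on ?A' \<Lambda>"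
    unfolding disjoint_family_on_def
  proof (intro ballI impI)
    fix l l' assume l: "l \<in> \<Lambda>" "l' \<in> \<Lambda>" "l \<noteq> l'"
    have "- l = - l'" if "l + x \<in> D" "l' + x \<in> D" for x
      by (rule ex1E[OF DD(2)[of x]]) (use that l sym in \<open>metis diff_minus_eq_add add.commute\<close>)
    with l show "?A' l \<inter> ?A' l' = {}" by auto
  qed
  ultimately have 2: "emeasure ds D' = (\<integral>\<^sup>+ l. emeasure ds (?A' l) \<partial>count_space \<Lambda>)"
    using emeasure_UN_countable[of \<Lambda> ?A' ds] cnt meas(2) by (simp add: s)
  have "emeasure ds (?A l) = emeasure ds (?A' l)" for l
  proof -
    have "{x. l + x \<in> ?A l} = ?A' l" by auto
    then show ?thesis using normalized_haar_translate[OF haar meas(1), of l l] by simp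
  qed
  then show ?thesis by (simp add: 1 2)
qed

lemma countable_poly_ring: "countable (poly_ring :: 'a::{field,finite} fls set)"
proof -
  have "poly_ring \<subseteq> (\<Union>n::nat. supp_in (- int n) 1 :: 'a fls set)"
  proof
    fix x :: "'a fls" assume "x \<in> poly_ring"
    moreover have "x \<in> fball (- int (nat (- fls_subdegree x)))" by (auto simp: fball_iff)
    ultimately show "x \<in> (\<Union>n::nat. supp_in (- int n) 1)"
      unfolding poly_ring_Int_fball_eq_supp_in[symmetric] by blast
  qed
  then show ?thesis by (rule countable_subset) (simp add: countable_finite)
qed

text \<open>
  Multiplication by \<open>a\<^sup>2\<close> carries the lattice to the polynomials and the ball
  used here to the maximal ideal, a fundamental domain for them.
\<close>

lemma covolume_stabU:
  fixes ds :: "'a::{field,finite} fls measure"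
  assumes haar: "normalized_haar ds" and a: "a \<noteq> 0"
  shows "covolume ds {s. a\<^sup>2 * s \<in> poly_ring} = ennreal (real CARD('a) powi (2 * fls_subdegree a - 1))"
proof -
  let ?L = "{s. a\<^sup>2 * s \<in> poly_ring}"
  let ?D = "fball (1 - 2 * fls_subdegree a) :: 'a fls set"
  have ball: "x \<in> ?D \<longleftrightarrow> a\<^sup>2 * x \<in> fball 1" for x
    using a by (simp add: fball_mult_iff fls_subdegree_pow)
  have L: "?L = (\<lambda>p. p / a\<^sup>2) ` poly_ring"
    using a by (auto simp: image_iff field_simps intro!: bexI[of _ "a\<^sup>2 * _"])
  have cnt: "countable ?L" unfolding L using countable_poly_ring by (rule countable_image)
  have sym: "- l \<in> ?L" if "l \<in> ?L" for l using that poly_ring_uminus by auto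
  have dom: "fundamental_domain ?L ?D"
    unfolding fundamental_domain_def
  proof (intro conjI allI)
    fix x :: "'a fls"
    obtain p where p: "p \<in> poly_ring" "a\<^sup>2 * x - p \<in> fball 1" using poly_ring_approx by blast
    show "\<exists>!l. l \<in> ?L \<and> x - l \<in> ?D"
    proof (rule ex1I[of _ "p / a\<^sup>2"])
      show "p / a\<^sup>2 \<in> ?L \<and> x - p / a\<^sup>2 \<in> ?D"
        using p a by (simp add: ball right_diff_distrib)
    next
      fix l assume l: "l \<in> ?L \<and> x - l \<in> ?D"
      then have "a\<^sup>2 * x - a\<^sup>2 * l \<in> fball 1" by (simp add: ball right_diff_distrib)
      from fball_diff[OF p(2) this] have "a\<^sup>2 * l - p \<in> fball 1" by simp
      moreover have "a\<^sup>2 * l - p \<in> poly_ring" using l p(1) by (simp add: poly_ring_diff)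
      ultimately have "a\<^sup>2 * l - p = 0" by (intro poly_ring_Int_fball)
      then show "l = p / a\<^sup>2" using a by (simp add: field_simps)
    qed
  qed (rule fball_borel)
  have "covolume ds ?L = emeasure ds ?D"
    unfolding covolume_def
    by (rule the_equality) (use dom fundamental_domain_emeasure_eq[OF haar cnt sym] in blast)+
  then show ?thesis by (simp add: emeasure_fball[OF haar] algebra_simps)
qed

lemma m_orbit_torus:
  fixes ds :: "'a::{field,finite} fls measure"
  assumes haar: "normalized_haar ds" and a: "a \<noteq> 0"
  shows "m_orbit ds (Uorbit (Gcoset (torus a))) = - fls_subdegree a"
  unfolding m_orbit_def stabU_torus[OF a] covolume_stabU[OF assms]
proof (rule the_equality)
  fix m assume "ennreal (real CARD('a) powi (2 * fls_subdegree a - 1)) = ennreal (real CARD('a) powi (- 2 * m - 1))"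
  moreover have q: "1 < real CARD('a)" using two_le_card_field[where 'a = 'a] by simp
  ultimately have "real CARD('a) powi (2 * fls_subdegree a - 1) = real CARD('a) powi (- 2 * m - 1)"
    by (subst (asm) ennreal_inj) simp_all
  then have "2 * fls_subdegree a - 1 = - 2 * m - 1"
    using power_int_strict_increasing[OF _ q] by (metis less_irrefl linorder_neqE)
  then show "m = - fls_subdegree a" by simp
qed simp

section \<open>The height along a translated periodic orbit\<close>

lemma card_poly_ring_near:
  fixes y :: "'a::{field,finite} fls"
  assumes M: "1 \<le> M"
  shows "finite {d \<in> poly_ring. y + d \<in> fball M}"
    and "card {d \<in> poly_ring. y + d \<in> fball M} = of_bool (trunc 1 M y = 0)"
proof -
  have "finite {d \<in> poly_ring. y + d \<in> fball M} \<and>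
    card {d \<in> poly_ring. y + d \<in> fball M} = of_bool (trunc 1 M y = 0)"
  proof (cases "trunc 1 M y = 0")
    case True
    obtain p where p: "p \<in> poly_ring" "y - p \<in> fball 1" using poly_ring_approx by blast
    have "y - p \<in> fball M"
      unfolding fball_def
    proof (intro CollectI allI impI)
      fix i assume i: "i < M"
      show "(y - p) $$ i = 0"
      proof (cases "i < 1")
        case False
        have "y $$ i = trunc 1 M y $$ i" using i False by simp
        with False p(1) True show ?thesis by (simp add: poly_ring_iff)
      qed (use p(2) in \<open>simp add: fball_def\<close>)
    qed
    moreover have "d = - p" if "d \<in> poly_ring" "y + d \<in> fball M" for d
    proof -
      have "y + d \<in> fball 1" using that(2) M by (rule fball_mono)
      from fball_diff[OF this p(2)] have "d + p \<in> fball 1" by simp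
      with that(1) p(1) have "d + p = 0" by (intro poly_ring_Int_fball poly_ring_add)
      then show ?thesis by (simp add: add_eq_0_iff2)
    qed
    ultimately have "{d \<in> poly_ring. y + d \<in> fball M} = {- p}"
      using p(1) by (auto intro: poly_ring_uminus)
    with True show ?thesis by simp
  next
    case False
    have "trunc 1 M y = 0" if "d \<in> poly_ring" "y + d \<in> fball M" for d
    proof (rule fls_zero_eqI)
      fix i
      show "trunc 1 M y $$ i = 0"
        using that by (auto simp: poly_ring_iff fball_def)
    qed
    with False have "{d \<in> poly_ring. y + d \<in> fball M} = {}" by blast
    then show ?thesis using False by (simp only: card.empty of_bool_eq simp_thms finite.emptyI)
  qed
  then show "finite {d \<in> poly_ring. y + d \<in> fball M}"
    and "card {d \<in> poly_ring. y + d \<in> fball M} = of_bool (trunc 1 M y = 0)" by blast+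
qed

text \<open>
  All fibres are translates of the kernel.
\<close>

lemma card_fiber_mult:
  fixes T :: "'b::ab_group_add \<Rightarrow> 'c::ab_group_add"
  assumes fin: "finite R" and diff: "\<And>x y. x \<in> R \<Longrightarrow> y \<in> R \<Longrightarrow> x - y \<in> R"
    and add: "\<And>x y. x \<in> R \<Longrightarrow> y \<in> R \<Longrightarrow> x + y \<in> R"
    and T: "\<And>x y. T (x + y) = T x + T y" and im: "T ` R = S" and y: "y \<in> S"
  shows "card {x \<in> R. T x = y} * card S = card R"
proof -
  have T_diff: "T (x - y) = T x - T y" for x y
    using T[of "x - y" y] by simp
  have same: "card {x \<in> R. T x = z} = card {x \<in> R. T x = 0}" if z: "z \<in> S" for z
  proof -
    obtain x0 where x0: "x0 \<in> R" "T x0 = z" using im z by blast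
    have "bij_betw (\<lambda>x. x + x0) {x \<in> R. T x = 0} {x \<in> R. T x = z}"
      by (rule bij_betw_byWitness[where f' = "\<lambda>x. x - x0"])
        (use x0 in \<open>auto simp: T T_diff intro: add diff\<close>)
    then show ?thesis by (rule bij_betw_same_card[symmetric])
  qed
  have "card R = (\<Sum>z\<in>S. card {x \<in> R. T x = z})"
    using sum.group[OF fin, of S T "\<lambda>_. 1 :: nat"] fin im by auto
  also have "\<dots> = (\<Sum>z\<in>S. card {x \<in> R. T x = y})"
    using same y by (intro sum.cong) simp_all
  finally show ?thesis by simp
qed

text \<open>
  Multiplication by \<open>c\<close> is surjective modulo polynomials: divide the target by
  \<open>c\<close>, discard the polynomial part and cut off at \<open>2N\<close>. The cut-off
  error, multiplied by \<open>c\<close>, has absolute value at most \<open>q^(-N-j)\<close> and is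
  invisible to the truncation.
\<close>

lemma card_trunc_mult_fiber:
  fixes c y :: "'a::{field,finite} fls"
  assumes c: "c \<in> fball (j - N)" "c \<in> poly_ring" "c \<noteq> 0" and N: "1 \<le> j" "j \<le> N"
    and y: "y \<in> supp_in 1 (N + j)"
  shows "card {r \<in> supp_in 1 (2 * N). trunc 1 (N + j) (c * r) = y} = CARD('a) ^ nat (N - j)"
proof -
  have im: "(\<lambda>r. trunc 1 (N + j) (c * r)) ` supp_in 1 (2 * N) = supp_in 1 (N + j)"
  proof (intro equalityI subsetI)
    fix z :: "'a fls" assume z: "z \<in> supp_in 1 (N + j)"
    obtain p where p: "p \<in> poly_ring" "z / c - p \<in> fball 1" using poly_ring_approx by blast
    define r where "r = trunc 1 (2 * N) (z / c - p)"
    have "z / c - p - r \<in> fball (2 * N)" using p(2) by (auto simp: r_def fball_def)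
    from fball_mult[OF c(1) this] have "c * (z / c - p - r) \<in> fball (N + j)" by (simp add: algebra_simps)
    then have "z - c * p - c * r \<in> fball (N + j)" using c(3) by (simp add: algebra_simps)
    then have "(z - c * p - c * r) $$ i = 0" if "i < N + j" for i using that by (simp add: fball_def)
    moreover have "(c * p) $$ i = 0" if "1 \<le> i" for i
      using poly_ring_mult[OF c(2) p(1)] that by (simp add: poly_ring_iff)
    ultimately have "z = trunc 1 (N + j) (c * r)"
      using z by (intro fls_eqI) (force simp: supp_in_def not_le not_less)
    moreover have "r \<in> supp_in 1 (2 * N)" unfolding r_def by (rule trunc_in_supp_in)
    ultimately show "z \<in> (\<lambda>r. trunc 1 (N + j) (c * r)) ` supp_in 1 (2 * N)" by blast
  qed (auto intro: trunc_in_supp_in)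
  have "card {r \<in> supp_in 1 (2 * N). trunc 1 (N + j) (c * r) = y} * card (supp_in 1 (N + j) :: 'a fls set) =
      card (supp_in 1 (2 * N) :: 'a fls set)"
    by (rule card_fiber_mult[OF _ _ _ _ im y]) (simp_all add: trunc_add distrib_left, auto simp: supp_in_def)
  moreover have "nat (2 * N - 1) = nat (N - j) + nat (N + j - 1)" using N by simp
  ultimately show ?thesis
    using two_le_card_field[where 'a = 'a] by (simp add: card_supp_in power_add)
qed

text \<open>
  A vector with first coordinate \<open>c\<close> is short when \<open>c\<close> has degree at
  most \<open>N - j\<close> and the fractional part of \<open>c (\<sigma> + r)\<close> is small.
  The second coordinate is then determined. For \<open>c = 0\<close> every \<open>r\<close>
  qualifies, and for each other \<open>c\<close> exactly \<open>q^(N-j)\<close> of them do,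
  whatever \<open>\<sigma>\<close> is.
\<close>

lemma sum_short_vectors_periodic:
  fixes b \<sigma> :: "'a::{field,finite} fls"
  assumes b: "b \<noteq> 0" "fls_subdegree b = N" and N: "1 \<le> j" "j \<le> N + 1"
  shows "(\<Sum>r\<in>supp_in 1 (2 * N). card (short_vectors j (uni (\<sigma> + r) ** torus b))) =
    CARD('a) ^ nat (2 * N - 1) + (CARD('a) ^ nat (N - j + 1) - 1) * CARD('a) ^ nat (N - j)"
proof -
  let ?C = "supp_in (j - N) 1 :: 'a fls set" and ?R = "supp_in 1 (2 * N) :: 'a fls set"
  have single: "card (short_vectors j (uni x ** torus b)) = (\<Sum>c\<in>?C. of_bool (trunc 1 (N + j) (c * x) = 0))" for x
  proof -
    have iff: "rowmul (c, d) (uni x ** torus b) \<in> fball j \<times> fball j \<longleftrightarrow>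
        c \<in> fball (j - N) \<and> c * x + d \<in> fball (N + j)" for c d
    proof -
      have iff: "rowmul (c, d) (uni x ** torus b) = (b * c, inverse b * (c * x + d))"
        by (simp add: rowmul_def uni_def torus_def mat2_mult algebra_simps)
      then show ?thesis using b by (simp add: fball_mult_iff add.commute)
    qed
    have "short_vectors j (uni x ** torus b) = Sigma ?C (\<lambda>c. {d \<in> poly_ring. c * x + d \<in> fball (N + j)})"
    proof (rule set_eqI)
      fix v :: "'a fls \<times> 'a fls"
      obtain c d where v: "v = (c, d)" by (cases v)
      show "v \<in> short_vectors j (uni x ** torus b) \<longleftrightarrow>
          v \<in> Sigma ?C (\<lambda>c. {d \<in> poly_ring. c * x + d \<in> fball (N + j)})"
        unfolding v short_vectors_def mem_Collect_eq iff mem_Sigma_iff poly_ring_Int_fball_eq_supp_in[symmetric]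
        by auto
    qed
    then show ?thesis using N by (simp add: card_poly_ring_near)
  qed
  have "(\<Sum>r\<in>?R. card (short_vectors j (uni (\<sigma> + r) ** torus b))) =
      (\<Sum>c\<in>?C. \<Sum>r\<in>?R. of_bool (trunc 1 (N + j) (c * (\<sigma> + r)) = 0))"
    unfolding single by (rule sum.swap)
  also have "\<dots> = (\<Sum>c\<in>?C. card {r \<in> ?R. trunc 1 (N + j) (c * (\<sigma> + r)) = 0})"
    by (simp add: of_bool_def sum.If_cases Int_def)
  also have "\<dots> = card ?R + (\<Sum>c\<in>?C - {0}. card {r \<in> ?R. trunc 1 (N + j) (c * (\<sigma> + r)) = 0})"
  proof -
    have "{r \<in> ?R. trunc 1 (N + j) (0 * (\<sigma> + r)) = 0} = ?R" by (auto simp: fls_eq_iff)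
    then show ?thesis by (subst sum.remove[of _ 0]) auto
  qed
  also have "(\<Sum>c\<in>?C - {0}. card {r \<in> ?R. trunc 1 (N + j) (c * (\<sigma> + r)) = 0}) =
      (\<Sum>c\<in>?C - {0}. CARD('a) ^ nat (N - j))"
  proof (rule sum.cong[OF refl])
    fix c assume "c \<in> ?C - {0}"
    then have c: "c \<in> fball (j - N)" "c \<in> poly_ring" "c \<noteq> 0"
      by (auto simp flip: poly_ring_Int_fball_eq_supp_in)
    \<comment> \<open>For \<open>j = N + 1\<close> the range of \<open>c\<close> consists of \<open>0\<close> alone.\<close>
    have "j \<noteq> N + 1" using c poly_ring_Int_fball[of c] by auto
    then have "j \<le> N" using N(2) by simp
    have "trunc 1 (N + j) (c * (\<sigma> + r)) = 0 \<longleftrightarrow> trunc 1 (N + j) (c * r) = trunc 1 (N + j) (- (c * \<sigma>))" for r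
    proof -
      have "trunc 1 (N + j) (c * (\<sigma> + r)) = trunc 1 (N + j) (c * r) - trunc 1 (N + j) (- (c * \<sigma>))"
        by (rule fls_eqI) (simp add: distrib_left)
      then show ?thesis by simp
    qed
    then show "card {r \<in> ?R. trunc 1 (N + j) (c * (\<sigma> + r)) = 0} = CARD('a) ^ nat (N - j)"
      using card_trunc_mult_fiber[OF c N(1) \<open>j \<le> N\<close> trunc_in_supp_in] by simp
  qed
  also have "\<dots> = (CARD('a) ^ nat (N - j + 1) - 1) * CARD('a) ^ nat (N - j)"
    by (simp add: card_supp_in algebra_simps)
  finally show ?thesis by (simp add: card_supp_in)
qed

text \<open>
  The normalized count does not depend on \<open>N\<close>: up to \<open>j = N\<close> it is
  already the limiting distribution.
\<close>

lemma periodic_height_sum: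
  fixes b \<sigma> :: "'a::{field,finite} fls"
  assumes b: "b \<noteq> 0" "fls_subdegree b = int N" and j: "1 \<le> j" "j \<le> N"
  defines "q \<equiv> real CARD('a)"
  shows "(\<Sum>r\<in>supp_in 1 (2 * int N). of_bool (hK (Gcoset (uni (\<sigma> + r) ** torus b)) < 2 * j)) =
    q ^ (2 * N - 1) * (1 - q * (1 / q ^ 2) ^ j)"
proof -
  define W where "W = (\<lambda>i g. real (card (short_vectors i (g :: 'a fls^2^2))))"
  let ?R = "supp_in 1 (2 * int N) :: 'a fls set"
  let ?g = "\<lambda>r. uni (\<sigma> + r) ** torus b"
  let ?D = "\<lambda>r. of_bool (hK (Gcoset (?g r)) < 2 * j) :: real"
  have q: "q > 1" using two_le_card_field[where 'a = 'a] by (simp add: q_def)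
  have D: "(q - 1) * ?D r = q * W (int j + 1) (?g r) - W (int j) (?g r)" for r
    using indicator_hK_eq_short_vectors[of "?g r" "int j"] j b(1) by (simp add: W_def q_def Ggrp_mult)
  have sum: "(\<Sum>r\<in>?R. W i (?g r)) =
      q ^ nat (2 * int N - 1) + (q ^ nat (int N - i + 1) - 1) * q ^ nat (int N - i)"
    if "1 \<le> i" "i \<le> int N + 1" for i
    using arg_cong[OF sum_short_vectors_periodic[OF b that, of \<sigma>], of real]
    by (simp add: W_def q_def of_nat_diff)
  define k where "k = N - j"
  have N: "N = j + k" using j by (simp add: k_def)
  have "q * (\<Sum>r\<in>?R. W (int j + 1) (?g r)) = q * q ^ (2 * N - 1) + (q ^ k - 1) * q ^ k"
  proof -
    have e: "nat (2 * int N - 1) = 2 * N - 1" "nat (int N - (int j + 1) + 1) = k"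
        "nat (int N - (int j + 1)) = k - 1" using j by (auto simp: N)
    have "q * ((q ^ k - 1) * q ^ (k - 1)) = (q ^ k - 1) * q ^ k"
      by (cases k) (simp_all add: algebra_simps)
    moreover have "(\<Sum>r\<in>?R. W (int j + 1) (?g r)) = q ^ (2 * N - 1) + (q ^ k - 1) * q ^ (k - 1)"
      using sum[of "int j + 1"] j unfolding e by simp
    ultimately show ?thesis by (simp only: distrib_left)
  qed
  moreover have "(\<Sum>r\<in>?R. W (int j) (?g r)) = q ^ (2 * N - 1) + (q * q ^ k - 1) * q ^ k"
  proof -
    have "nat (2 * int N - 1) = 2 * N - 1" "nat (int N - int j + 1) = Suc k" "nat (int N - int j) = k"
      using j by (auto simp: N)
    then show ?thesis using sum[of "int j"] j by simp
  qed
  moreover have "(q - 1) * (\<Sum>r\<in>?R. ?D r) =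
      q * (\<Sum>r\<in>?R. W (int j + 1) (?g r)) - (\<Sum>r\<in>?R. W (int j) (?g r))"
    by (simp only: sum_distrib_left D sum_subtractf)
  ultimately have "(q - 1) * (\<Sum>r\<in>?R. ?D r) =
      q * q ^ (2 * N - 1) + (q ^ k - 1) * q ^ k - (q ^ (2 * N - 1) + (q * q ^ k - 1) * q ^ k)"
    by (simp only:)
  also have "\<dots> = (q - 1) * (q ^ (2 * N - 1) - q ^ (2 * k))"
    by (simp add: algebra_simps power_mult power2_eq_square)
  also have "q ^ (2 * k) = q ^ (2 * N - 1) * (q * (1 / q ^ 2) ^ j)"
  proof -
    have "q ^ (2 * N - 1) * q = q ^ (2 * N)" using j q by (metis N add_is_0 less_one mult_is_0 not_less power_minus_mult zero_less_iff_neq_zero zero_neq_numeral)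
    also have "\<dots> = q ^ (2 * k) * (q ^ 2) ^ j" by (simp add: N power_add power_mult power_mult_distrib flip: power_mult)
    finally show ?thesis using q by (simp add: field_simps)
  qed
  finally have "(q - 1) * (\<Sum>r\<in>?R. ?D r) = (q - 1) * (q ^ (2 * N - 1) - q ^ (2 * N - 1) * (q * (1 / q ^ 2) ^ j))" .
  then have "(\<Sum>r\<in>?R. ?D r) = q ^ (2 * N - 1) - q ^ (2 * N - 1) * (q * (1 / q ^ 2) ^ j)"
    by (rule mult_left_cancel[THEN iffD1, rotated]) (use q in simp)
  then show ?thesis by (simp only: right_diff_distrib mult_1_right)
qed

text \<open>
  By invariance the integral over \<open>Y\<close> does not change when the integrand is averaged
  over the points \<open>y u(r / a\<^sup>2)\<close>, and by \<open>periodic_height_sum\<close>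
  this average is the same number at every point \<open>y\<close>.
\<close>

lemma invariant_prob_orbit_height:
  fixes \<nu> :: "'a::{field,finite} point measure"
  assumes a: "a \<noteq> 0" and Y: "Y = Uorbit (Gcoset (torus a))" and inv: "invariant_prob_orbit Y \<nu>"
    and N: "int N = int n + fls_subdegree a" and j: "1 \<le> j" "j \<le> N"
  shows "measure \<nu> {y \<in> Y. hK (ract y (adiag (- int n))) < 2 * j} =
    1 - real CARD('a) * (1 / real CARD('a) ^ 2) ^ j"
proof -
  interpret prob_space \<nu> using inv by (simp add: invariant_prob_orbit_def)
  have sp: "space \<nu> = Y" and sets: "sets \<nu> = sets (borel_on (subtopology Xtop Y))"
    and distr: "\<And>s. distr \<nu> \<nu> (\<lambda>y. ract y (uni s)) = \<nu>"
    using inv by (auto simp: invariant_prob_orbit_def)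
  let ?h = "adiag (- int n) :: 'a fls^2^2"
  define q where "q = real CARD('a)"
  have q: "q > 1" using two_le_card_field[where 'a = 'a] by (simp add: q_def)
  define D where "D = (\<lambda>y. of_bool (hK (ract y ?h) < 2 * j) :: real)"
  have YX: "Y \<subseteq> Xsp" using a by (auto simp: Y Uorbit_def intro!: ract_in_Xsp Gcoset_in_Xsp)
  have meas: "{y \<in> Y. hK (ract y ?h) < 2 * j} \<in> events"
  proof -
    have "openin Xtop {x \<in> topspace Xtop. ract x ?h \<in> {x \<in> Xsp. hK x \<in> {..<2 * j}}}"
      by (rule openin_continuous_map_preimage[OF continuous_map_ract openin_hK]) simp
    then have "openin (subtopology Xtop Y) (Y \<inter> {x \<in> topspace Xtop. ract x ?h \<in> {x \<in> Xsp. hK x \<in> {..<2 * j}}})"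
      by (simp add: openin_subtopology_Int2)
    moreover have "Y \<inter> {x \<in> topspace Xtop. ract x ?h \<in> {x \<in> Xsp. hK x \<in> {..<2 * j}}} = {y \<in> Y. hK (ract y ?h) < 2 * j}"
      using YX by (auto simp: topspace_Xtop intro: ract_in_Xsp)
    ultimately show ?thesis by (simp add: sets borel_on_openin)
  qed
  have D_meas: "D \<in> borel_measurable \<nu>"
  proof -
    have "D \<in> borel_measurable \<nu> \<longleftrightarrow>
        (indicator {y \<in> Y. hK (ract y ?h) < 2 * j} :: _ \<Rightarrow> real) \<in> borel_measurable \<nu>"
      by (rule measurable_cong) (auto simp: D_def sp)
    then show ?thesis using meas by simp
  qed
  have act: "(\<lambda>y. ract y (uni s)) \<in> measurable \<nu> \<nu>" for s
  proof -
    have "ract y (uni s) \<in> Y" if "y \<in> Y" for y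
      using that by (auto simp: Y Uorbit_def ract_ract uni_mult)
    then have "continuous_map (subtopology Xtop Y) (subtopology Xtop Y) (\<lambda>y. ract y (uni s))"
      by (auto simp: continuous_map_in_subtopology intro!: continuous_map_from_subtopology continuous_map_ract)
    from measurable_borel_on[OF this] show ?thesis by (simp add: sets cong: measurable_cong_sets)
  qed
  have D_inv: "(\<integral>y. D (ract y (uni s)) \<partial>\<nu>) = (\<integral>y. D y \<partial>\<nu>)" for s
    using integral_distr[OF act D_meas, of s] by (simp add: distr)
  have int_D: "integrable \<nu> (\<lambda>y. D (ract y (uni s)))" for s
    by (rule integrable_const_bound[where B = 1, OF _ measurable_compose[OF act D_meas]])
      (auto simp: D_def)
  let ?R = "supp_in 1 (2 * int N) :: 'a fls set"
  \<comment> \<open>The torus part of the translated orbit; its valuation is \<open>N\<close>.\<close>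
  define b where "b = a * tpow (- int n)"
  have b: "b \<noteq> 0" "fls_subdegree b = int N"
    using a N unfolding b_def by (simp_all only: mult_eq_0_iff tpow_nonzero fls_subdegree_mult subdegree_tpow simp_thms not_False_eq_True)
  have avg: "(\<Sum>r\<in>?R. D (ract y (uni (r / a\<^sup>2)))) = q ^ (2 * N - 1) * (1 - q * (1 / q ^ 2) ^ j)"
    if yY: "y \<in> Y" for y
  proof -
    obtain s where y: "y = Gcoset (torus a ** uni s)"
      using yY unfolding Y Uorbit_def ract_Gcoset by blast
    have "ract (ract y (uni (r / a\<^sup>2))) ?h = Gcoset (uni (a\<^sup>2 * s + r) ** torus b)" for r
    proof -
      have "torus a ** ?h = torus b"
        using a by (simp add: torus_def adiag_def mat2_mult b_def mat2_eq_iff power_int_minus)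
      moreover have "torus a ** uni (s + r / a\<^sup>2) = uni (a\<^sup>2 * s + r) ** torus a"
        using a by (simp add: torus_uni distrib_left)
      ultimately show ?thesis
        by (simp add: y ract_Gcoset ract_ract uni_mult flip: matrix_mul_assoc)
    qed
    then show ?thesis
      using periodic_height_sum[OF b j, of "a\<^sup>2 * s"] by (simp add: D_def q_def)
  qed
  have cR: "real (card ?R) = q ^ (2 * N - 1)"
  proof -
    have "nat (2 * int N - 1) = 2 * N - 1" by simp
    then show ?thesis by (simp add: card_supp_in q_def)
  qed
  have "q ^ (2 * N - 1) * (\<integral>y. D y \<partial>\<nu>) = (\<Sum>r\<in>?R. \<integral>y. D (ract y (uni (r / a\<^sup>2))) \<partial>\<nu>)"
    by (simp add: D_inv cR)
  also have "\<dots> = (\<integral>y. (\<Sum>r\<in>?R. D (ract y (uni (r / a\<^sup>2)))) \<partial>\<nu>)"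
    by (simp add: int_D)
  also have "\<dots> = (\<integral>y. q ^ (2 * N - 1) * (1 - q * (1 / q ^ 2) ^ j) \<partial>\<nu>)"
    by (rule Bochner_Integration.integral_cong[OF refl]) (simp add: sp avg)
  also have "\<dots> = q ^ (2 * N - 1) * (1 - q * (1 / q ^ 2) ^ j)" by (simp add: prob_space)
  finally have "(\<integral>y. D y \<partial>\<nu>) = 1 - q * (1 / q ^ 2) ^ j" using q by simp
  moreover have "(\<integral>y. D y \<partial>\<nu>) = (\<integral>y. indicator {y \<in> Y. hK (ract y ?h) < 2 * j} y \<partial>\<nu>)"
    by (intro Bochner_Integration.integral_cong) (auto simp: D_def sp)
  ultimately show ?thesis using meas by (simp add: q_def)
qed

section \<open>Comparison of the two height distributions\<close>

text \<open>
  The values of \<open>h\<close> below \<open>2N\<close> contribute an expression in the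
  distribution function of \<open>h\<close> at \<open>0, 2, \<dots>, 2N\<close>; the remaining
  ones contribute at most \<open>B\<close> times their mass. Two variables whose distribution
  functions agree at these points can thus be compared.
\<close>

lemma (in prob_space) integral_even_split:
  fixes \<Phi> :: "nat \<Rightarrow> complex"
  assumes h: "h \<in> measurable M (count_space UNIV)" and even: "\<And>x. x \<in> space M \<Longrightarrow> even (h x)"
    and B: "\<And>k. even k \<Longrightarrow> cmod (\<Phi> k) \<le> B"
  shows "cmod ((\<integral>x. \<Phi> (h x) \<partial>M) -
      (\<Sum>i<N. complex_of_real (prob {x \<in> space M. h x < 2 * Suc i} - prob {x \<in> space M. h x < 2 * i}) * \<Phi> (2 * i)))
    \<le> B * (1 - prob {x \<in> space M. h x < 2 * N})"
proof -
  have ev: "{x \<in> space M. P (h x)} \<in> events" for P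
    using measurable_sets[OF h, of "{k. P k}"] by (simp add: vimage_def Int_def conj_commute)
  define A where "A = (\<lambda>i. {x \<in> space M. h x = 2 * i})"
  define T where "T = {x \<in> space M. \<not> h x < 2 * N}"
  have A: "A i \<in> events" and T: "T \<in> events" for i unfolding A_def T_def by (rule ev)+
  have pA: "prob (A i) = prob {x \<in> space M. h x < 2 * Suc i} - prob {x \<in> space M. h x < 2 * i}" for i
  proof -
    have "A i = {x \<in> space M. h x < 2 * Suc i} - {x \<in> space M. h x < 2 * i}"
    proof (intro equalityI subsetI)
      fix x assume x: "x \<in> {x \<in> space M. h x < 2 * Suc i} - {x \<in> space M. h x < 2 * i}"
      then obtain k where "h x = 2 * k" using even by (metis (lifting) DiffD1 evenE mem_Collect_eq)
      with x show "x \<in> A i" by (auto simp: A_def)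
    qed (auto simp: A_def)
    moreover have "{x \<in> space M. h x < 2 * i} \<subseteq> {x \<in> space M. h x < 2 * Suc i}" by auto
    ultimately show ?thesis using ev by (simp add: finite_measure_Diff)
  qed
  have pT: "prob T = 1 - prob {x \<in> space M. h x < 2 * N}"
    unfolding T_def by (rule prob_neg[OF ev])
  have B0: "B \<ge> 0" using B[of 0] by (metis dvd_0_right norm_ge_zero order_trans)
  have meas: "(\<lambda>x. \<Phi> (h x)) \<in> borel_measurable M"
    by (rule measurable_compose[OF h]) simp
  have eq: "\<Phi> (h x) = (\<Sum>i<N. indicator (A i) x *\<^sub>R \<Phi> (2 * i)) + indicator T x *\<^sub>R \<Phi> (h x)"
    if "x \<in> space M" for x
  proof (cases "h x < 2 * N")
    case True
    from even[OF that] obtain k where k: "h x = 2 * k" by blast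
    have "(\<Sum>i<N. indicator (A i) x *\<^sub>R \<Phi> (2 * i)) = (\<Sum>i<N. if i = k then \<Phi> (2 * i) else 0)"
      by (rule sum.cong) (use that k in \<open>auto simp: A_def\<close>)
    also have "\<dots> = \<Phi> (h x)" using True k by simp
    finally show ?thesis using True by (simp add: T_def)
  next
    case False
    then have "indicator (A i) x = (0::real)" if "i < N" for i using that by (auto simp: A_def)
    with False that show ?thesis by (simp add: T_def)
  qed
  have int_T: "integrable M (\<lambda>x. indicator T x *\<^sub>R \<Phi> (h x))"
    by (rule integrable_const_bound[where B = B])
      (use T meas B B0 even in \<open>auto simp: indicator_def intro!: AE_I2\<close>)
  have "(\<integral>x. \<Phi> (h x) \<partial>M) = (\<integral>x. (\<Sum>i<N. indicator (A i) x *\<^sub>R \<Phi> (2 * i)) + indicator T x *\<^sub>R \<Phi> (h x) \<partial>M)"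
    by (rule Bochner_Integration.integral_cong[OF refl eq])
  also have "\<dots> = (\<Sum>i<N. prob (A i) *\<^sub>R \<Phi> (2 * i)) + (\<integral>x. indicator T x *\<^sub>R \<Phi> (h x) \<partial>M)"
  proof -
    have int_A: "integrable M (\<lambda>x. indicator (A i) x *\<^sub>R \<Phi> (2 * i))" for i
      using A by (intro integrable_scaleR_left integrable_real_indicator) (simp_all add: emeasure_eq_measure)
    have "(\<integral>x. indicator (A i) x *\<^sub>R \<Phi> (2 * i) \<partial>M) = prob (A i) *\<^sub>R \<Phi> (2 * i)" for i
      using A by (subst Bochner_Integration.integral_scaleR_left)
        (simp_all add: integrable_real_indicator emeasure_eq_measure)
    then show ?thesis
      by (subst Bochner_Integration.integral_add[OF Bochner_Integration.integrable_sum[OF int_A] int_T])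
        (simp only: Bochner_Integration.integral_sum[OF int_A])
  qed
  finally have "(\<integral>x. \<Phi> (h x) \<partial>M) - (\<Sum>i<N. prob (A i) *\<^sub>R \<Phi> (2 * i)) = (\<integral>x. indicator T x *\<^sub>R \<Phi> (h x) \<partial>M)"
    by simp
  moreover have "cmod (\<integral>x. indicator T x *\<^sub>R \<Phi> (h x) \<partial>M) \<le> B * prob T"
  proof -
    have "cmod (\<integral>x. indicator T x *\<^sub>R \<Phi> (h x) \<partial>M) \<le> (\<integral>x. B * indicator T x \<partial>M)"
    proof (rule order_trans[OF integral_norm_bound], rule integral_mono[OF integrable_norm[OF int_T]])
      show "integrable M (\<lambda>x. B * indicator T x)"
        using T by (intro integrable_mult_right integrable_real_indicator) (simp_all add: emeasure_eq_measure)
      show "norm (indicator T x *\<^sub>R \<Phi> (h x)) \<le> B * indicator T x" if "x \<in> space M" for x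
        using B even[OF that] by (simp add: indicator_def)
    qed
    also have "\<dots> = B * prob T" using T by simp
    finally show ?thesis .
  qed
  ultimately show ?thesis by (simp add: pA pT scaleR_conv_of_real)
qed

theorem theorem4p5:
  shows "\<exists>C::real. \<forall>(ds :: 'a::{field,finite} fls measure) (\<mu> :: 'a point measure)
      (Y :: 'a point set) (\<nu> :: 'a point measure) (\<Phi> :: nat \<Rightarrow> complex).
    normalized_haar ds \<longrightarrow> invariant_prob_X \<mu> \<longrightarrow>
    compact_Uorbit Y \<longrightarrow> invariant_prob_orbit Y \<nu> \<longrightarrow> bounded (\<Phi> ` {k. even k}) \<longrightarrow>
      (\<forall>n::nat. int n > m_orbit ds Y \<longrightarrow>
         cmod (lambda_per \<nu> n (\<Phi> \<circ> hK) - (\<integral>x. (\<Phi> \<circ> hK) x \<partial>\<mu>))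
           \<le> C * sup_norm_even \<Phi> * real CARD('a) powi (- (int n - m_orbit ds Y - 1))) \<and>
      (\<lambda>n. lambda_per \<nu> n (\<Phi> \<circ> hK)) \<longlonglongrightarrow> (\<integral>x. (\<Phi> \<circ> hK) x \<partial>\<mu>)"
proof (intro exI[of _ 2] allI impI)
  fix ds :: "'a fls measure" and \<mu> :: "'a point measure" and Y :: "'a point set"
    and \<nu> :: "'a point measure" and \<Phi> :: "nat \<Rightarrow> complex"
  assume haar: "normalized_haar ds" and \<mu>: "invariant_prob_X \<mu>" and Y: "compact_Uorbit Y"
    and \<nu>: "invariant_prob_orbit Y \<nu>" and bdd: "bounded (\<Phi> ` {k. even k})"
  define q where "q = real CARD('a)"
  have q: "q > 1" using two_le_card_field[where 'a = 'a] by (simp add: q_def)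
  obtain a where a: "a \<noteq> 0" and Ya: "Y = Uorbit (Gcoset (torus a))"
    using compact_Uorbit_cusp[OF Y] by blast
  define m where "m = m_orbit ds Y"
  have m: "m = - fls_subdegree a" unfolding m_def Ya by (rule m_orbit_torus[OF haar a])
  define B where "B = sup_norm_even \<Phi>"
  have B: "cmod (\<Phi> k) \<le> B" if "even k" for k
    unfolding B_def sup_norm_even_def
  proof (rule cSUP_upper)
    show "bdd_above ((\<lambda>k. cmod (\<Phi> k)) ` {k. even k})"
      using bounded_imp_bdd_above[of "(\<lambda>k. cmod (\<Phi> k)) ` {k. even k}"] bdd by (simp add: bounded_norm_comp)
  qed (use that in simp)
  have B0: "B \<ge> 0" using B[of 0] by (metis dvd_0_right norm_ge_zero order_trans)
  interpret X: prob_space \<mu> using \<mu> by (simp add: invariant_prob_X_def)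
  interpret O: prob_space \<nu> using \<nu> by (simp add: invariant_prob_orbit_def)
  have spX: "space \<mu> = Xsp" and setsX: "sets \<mu> = sets (borel_on Xtop)"
    using \<mu> by (auto simp: invariant_prob_X_def)
  have spO: "space \<nu> = Y" and setsO: "sets \<nu> = sets (borel_on (subtopology Xtop Y))"
    using \<nu> by (auto simp: invariant_prob_orbit_def)
  have YX: "Y \<subseteq> Xsp" using a by (auto simp: Ya Uorbit_def intro!: ract_in_Xsp Gcoset_in_Xsp)
  have evenX: "even (hK x)" if "x \<in> Xsp" for x :: "'a point"
    using that by (auto elim!: Xsp_cases intro: even_hK)
  have measX: "hK \<in> measurable (borel_on Xtop) (count_space UNIV)"
    by (rule measurableI) (simp_all add: space_borel_on topspace_Xtop vimage_def Int_def conj_commute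
        borel_on_openin openin_hK)
  have estimate: "cmod (lambda_per \<nu> n (\<Phi> \<circ> hK) - (\<integral>x. (\<Phi> \<circ> hK) x \<partial>\<mu>))
       \<le> 2 * B * q powi (- (int n - m - 1))" if n: "int n > m" for n
  proof -
    define N where "N = nat (int n - m)"
    have N: "int N = int n + fls_subdegree a" "1 \<le> N" using n by (auto simp: N_def m)
    let ?h = "\<lambda>y. hK (ract y (adiag (- int n)))"
    define e where "e = (\<lambda>j::nat. 1 - q * (1 / q ^ 2) ^ j)"
    \<comment> \<open>The common distribution function at \<open>2j\<close>; the formula \<open>e\<close> is valid for positive \<open>j\<close> only.\<close>
    define p where "p = (\<lambda>j::nat. if j = 0 then 0 else e j)"
    have pX: "X.prob {x \<in> Xsp. hK x < 2 * j} = p j" for j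
      using invariant_prob_X_height[OF \<mu>, of j] by (simp add: p_def e_def q_def)
    have pO: "O.prob {y \<in> space \<nu>. ?h y < 2 * j} = p j" if "j \<le> N" for j
      using invariant_prob_orbit_height[OF a Ya \<nu> N(1), of j] that by (simp add: spO p_def e_def q_def)
    have hX: "hK \<in> measurable \<mu> (count_space UNIV)"
      using measX by (simp only: measurable_cong_sets[OF setsX refl])
    have "(\<lambda>y. ract y (adiag (- int n))) \<in> measurable (borel_on (subtopology Xtop Y)) (borel_on Xtop)"
      by (intro measurable_borel_on continuous_map_from_subtopology continuous_map_ract) simp
    from measurable_compose[OF this measX] have hO: "?h \<in> measurable \<nu> (count_space UNIV)"
      by (simp only: measurable_cong_sets[OF setsO refl])
    define S where "S = (\<Sum>i<N. complex_of_real (p (Suc i) - p i) * \<Phi> (2 * i))"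
    have "cmod ((\<integral>x. \<Phi> (hK x) \<partial>\<mu>) - S) \<le> B * (1 - p N)"
      using X.integral_even_split[where \<Phi> = \<Phi> and N = N and B = B, OF hX _ B] evenX
      unfolding S_def spX pX by blast
    moreover have "cmod ((\<integral>y. \<Phi> (?h y) \<partial>\<nu>) - S) \<le> B * (1 - p N)"
    proof -
      have "S = (\<Sum>i<N. complex_of_real (O.prob {y \<in> space \<nu>. ?h y < 2 * Suc i} -
          O.prob {y \<in> space \<nu>. ?h y < 2 * i}) * \<Phi> (2 * i))"
        unfolding S_def by (rule sum.cong[OF refl]) (simp only: pO lessThan_iff Suc_le_eq less_imp_le)
      moreover have "even (?h y)" if "y \<in> space \<nu>" for y
        using that YX by (auto simp: spO intro!: evenX ract_in_Xsp)
      ultimately show ?thesis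
        using O.integral_even_split[where \<Phi> = \<Phi> and N = N and B = B, OF hO _ B]
        unfolding pO[OF order_refl] by simp
    qed
    ultimately have "cmod ((\<integral>y. \<Phi> (?h y) \<partial>\<nu>) - (\<integral>x. \<Phi> (hK x) \<partial>\<mu>)) \<le> B * (1 - p N) + B * (1 - p N)"
      by (metis (no_types, lifting) add_mono norm_diff_triangle_le norm_minus_commute)
    also have "\<dots> = 2 * B * (q * (1 / q ^ 2) ^ N)" using N(2) by (simp add: p_def e_def)
    also have "\<dots> \<le> 2 * B * q powi (- (int n - m - 1))"
    proof -
      have "q * (1 / q ^ 2) ^ N = q powi (1 - 2 * int N)"
      proof -
        have "q powi (1 - 2 * int N) = q / q powi (int (2 * N))"
          using q by (simp add: power_int_diff)
        then show ?thesis by (simp only: power_int_of_nat) (simp add: power_mult power_divide)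
      qed
      also have "\<dots> \<le> q powi (- (int n - m - 1))"
        using q N by (intro power_int_increasing) (simp_all add: m)
      finally show ?thesis using B0 by (intro mult_left_mono) simp_all
    qed
    finally show ?thesis by (simp add: lambda_per_def comp_def)
  qed
  show "(\<forall>n::nat. int n > m_orbit ds Y \<longrightarrow>
         cmod (lambda_per \<nu> n (\<Phi> \<circ> hK) - (\<integral>x. (\<Phi> \<circ> hK) x \<partial>\<mu>))
           \<le> 2 * sup_norm_even \<Phi> * real CARD('a) powi (- (int n - m_orbit ds Y - 1))) \<and>
      (\<lambda>n. lambda_per \<nu> n (\<Phi> \<circ> hK)) \<longlonglongrightarrow> (\<integral>x. (\<Phi> \<circ> hK) x \<partial>\<mu>)"
  proof
    show "\<forall>n::nat. int n > m_orbit ds Y \<longrightarrow>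
         cmod (lambda_per \<nu> n (\<Phi> \<circ> hK) - (\<integral>x. (\<Phi> \<circ> hK) x \<partial>\<mu>))
           \<le> 2 * sup_norm_even \<Phi> * real CARD('a) powi (- (int n - m_orbit ds Y - 1))"
      using estimate by (simp only: m_def B_def q_def) blast
    have "(\<lambda>n. 2 * B * q powi (m + 1) * (1 / q) ^ n) \<longlonglongrightarrow> 2 * B * q powi (m + 1) * 0"
      by (intro tendsto_intros LIMSEQ_power_zero) (use q in simp)
    moreover have "q powi (- (int n - m - 1)) = q powi (m + 1) * (1 / q) ^ n" for n
    proof -
      have "q powi (- (int n - m - 1)) = q powi (m + 1 - int n)" by (simp add: algebra_simps)
      also have "\<dots> = q powi (m + 1) / q powi int n" using q by (intro power_int_diff) simp
      finally show ?thesis by (simp add: power_one_over divide_inverse power_inverse)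
    qed
    ultimately have "(\<lambda>n. 2 * B * q powi (- (int n - m - 1))) \<longlonglongrightarrow> 0"
      by (simp add: mult.assoc)
    moreover have "\<forall>\<^sub>F n in sequentially. cmod (lambda_per \<nu> n (\<Phi> \<circ> hK) - (\<integral>x. (\<Phi> \<circ> hK) x \<partial>\<mu>))
        \<le> 2 * B * q powi (- (int n - m - 1))"
      using eventually_gt_at_top[of "nat m"] by eventually_elim (rule estimate, simp)
    ultimately have "(\<lambda>n. lambda_per \<nu> n (\<Phi> \<circ> hK) - (\<integral>x. (\<Phi> \<circ> hK) x \<partial>\<mu>)) \<longlonglongrightarrow> 0"
      by (rule Lim_null_comparison[rotated])
    then show "(\<lambda>n. lambda_per \<nu> n (\<Phi> \<circ> hK)) \<longlonglongrightarrow> (\<integral>x. (\<Phi> \<circ> hK) x \<partial>\<mu>)"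
      by (rule LIM_zero_cancel)
  qed
qed

end
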